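(* Let $\rho\in\mathbb{R}$, $\rho\neq0$, and let $(M^n,\bar g)$, $n\ge3$, be a Riemannian gradient $\rho$-Einstein soliton that is locally conformally flat and rotationally symmetric, with zero scalar curvature. Then $(M^n,\bar g)$ is necessarily steady. Moreover, $(M^n,\bar g)$ is flat.
   Context: A Riemannian manifold $(M^n,\bar g)$, $n\ge3$, is a gradient $\rho$-Einstein soliton ($\rho\in\mathbb{R}$, $\rho\ne0$) if there is a smooth function $h:M\to\mathbb{R}$ (the potential function) such that $\mathrm{Ric}_{\bar g}+\mathrm{Hess}_{\bar g}h=\rho K_{\bar g}\,\bar g+\lambda\bar g$ for some constant $\lambda\in\mathbb{R}$, where $K_{\bar g}$ is the scalar curvature of $\bar g$. It is called steady if $\lambda=0$.
   Formalization: "Steady" is taken to mean that some potential function satisfies the soliton equation with λ=0; λ=0 for every given potential fails for flat R^n with h=λ|x|²/2, λ≠0. *)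

theory Defs
  imports "HOL-Analysis.Analysis"
begin

section \<open>Smooth functions on open subsets of Euclidean space\<close>

definition partial :: "'n::finite \<Rightarrow> (real^'n \<Rightarrow> real) \<Rightarrow> real^'n \<Rightarrow> real" where
  "partial i f x = frechet_derivative f (at x) (axis i 1)"

text \<open>The two notions of smoothness below are only meaningful, and only used, for open \<open>S\<close>.\<close>

primrec Ck_on :: "nat \<Rightarrow> (real^'n::finite) set \<Rightarrow> (real^'n \<Rightarrow> real) \<Rightarrow> bool" where
  "Ck_on 0 S f \<longleftrightarrow> continuous_on S f"
| "Ck_on (Suc k) S f \<longleftrightarrow> (\<forall>x\<in>S. f differentiable (at x)) \<and> (\<forall>i. Ck_on k S (partial i f))"

definition smooth_on :: "(real^'n::finite) set \<Rightarrow> (real^'n \<Rightarrow> real) \<Rightarrow> bool" where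
  "smooth_on S f \<longleftrightarrow> (\<forall>k. Ck_on k S f)"

definition smooth_map_on :: "(real^'n::finite) set \<Rightarrow> (real^'n \<Rightarrow> real^'m::finite) \<Rightarrow> bool" where
  "smooth_map_on S f \<longleftrightarrow> (\<forall>i. smooth_on S (\<lambda>x. f x $ i))"

section \<open>Smooth manifolds\<close>

text \<open>A chart is a pair of its domain and its coordinate map; the values of the coordinate map
  outside the domain are irrelevant.\<close>

type_synonym ('a, 'n) chart = "'a set \<times> ('a \<Rightarrow> real^'n)"

definition chart_image :: "('a, 'n::finite) chart \<Rightarrow> (real^'n) set" where
  "chart_image c = snd c ` fst c"

definition chart_inv :: "('a, 'n::finite) chart \<Rightarrow> real^'n \<Rightarrow> 'a" where
  "chart_inv c = inv_into (fst c) (snd c)"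

definition is_chart :: "'a topology \<Rightarrow> ('a, 'n::finite) chart \<Rightarrow> bool" where
  "is_chart X c \<longleftrightarrow> openin X (fst c) \<and> open (chart_image c) \<and>
     homeomorphic_map (subtopology X (fst c)) (top_of_set (chart_image c)) (snd c)"

definition transition :: "('a, 'n::finite) chart \<Rightarrow> ('a, 'n) chart \<Rightarrow> real^'n \<Rightarrow> real^'n" where
  "transition c d = snd d \<circ> chart_inv c"

definition overlap_image :: "('a, 'n::finite) chart \<Rightarrow> ('a, 'n) chart \<Rightarrow> (real^'n) set" where
  "overlap_image c d = snd c ` (fst c \<inter> fst d)"

definition compatible :: "('a, 'n::finite) chart \<Rightarrow> ('a, 'n) chart \<Rightarrow> bool" where
  "compatible c d \<longleftrightarrow> smooth_map_on (overlap_image c d) (transition c d) \<and>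
     smooth_map_on (overlap_image d c) (transition d c)"

text \<open>The smooth structure is the maximal atlas \<open>A\<close>; the dimension is \<open>CARD('n)\<close>.\<close>

definition smooth_manifold :: "'a topology \<Rightarrow> ('a, 'n::finite) chart set \<Rightarrow> bool" where
  "smooth_manifold X A \<longleftrightarrow> Hausdorff_space X \<and> second_countable X \<and>
     (\<forall>c\<in>A. is_chart X c) \<and> (\<Union>c\<in>A. fst c) = topspace X \<and>
     (\<forall>c\<in>A. \<forall>d\<in>A. compatible c d) \<and>
     (\<forall>c. is_chart X c \<and> (\<forall>d\<in>A. compatible c d) \<longrightarrow> c \<in> A)"

definition smooth_function :: "('a, 'n::finite) chart set \<Rightarrow> ('a \<Rightarrow> real) \<Rightarrow> bool" where
  "smooth_function A h \<longleftrightarrow> (\<forall>c\<in>A. smooth_on (chart_image c) (h \<circ> chart_inv c))"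

section \<open>Riemannian metrics and their curvature\<close>

text \<open>A metric is given by its component matrices in all charts: \<open>g c x $ i $ j\<close> is
  \<open>g(\<partial>\<^sub>i, \<partial>\<^sub>j)\<close> at the point with coordinates \<open>x\<close> in the chart \<open>c\<close>.\<close>

type_synonym ('a, 'n) metric = "('a, 'n) chart \<Rightarrow> real^'n \<Rightarrow> real^'n^'n"

definition riemannian_metric :: "('a, 'n::finite) chart set \<Rightarrow> ('a, 'n) metric \<Rightarrow> bool" where
  "riemannian_metric A g \<longleftrightarrow>
     (\<forall>c\<in>A. \<forall>i j. smooth_on (chart_image c) (\<lambda>x. g c x $ i $ j)) \<and>
     (\<forall>c\<in>A. \<forall>x\<in>chart_image c. transpose (g c x) = g c x \<and>
        (\<forall>v. v \<noteq> 0 \<longrightarrow> v \<bullet> (g c x *v v) > 0)) \<and>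
     (\<forall>c\<in>A. \<forall>d\<in>A. \<forall>x\<in>overlap_image c d.
        let J = jacobian (transition c d) (at x)
        in g c x = transpose J ** g d (transition c d x) ** J)"

definition riemannian_manifold ::
  "'a topology \<Rightarrow> ('a, 'n::finite) chart set \<Rightarrow> ('a, 'n) metric \<Rightarrow> bool" where
  "riemannian_manifold X A g \<longleftrightarrow> smooth_manifold X A \<and> riemannian_metric A g"

text \<open>In the following, \<open>G\<close> is the matrix-valued function of the metric in one chart.
  \<open>christoffel G k i j\<close> is \<open>\<Gamma>\<^sup>k\<^sub>i\<^sub>j\<close>.\<close>

definition christoffel ::
  "(real^'n::finite \<Rightarrow> real^'n^'n) \<Rightarrow> 'n \<Rightarrow> 'n \<Rightarrow> 'n \<Rightarrow> real^'n \<Rightarrow> real" where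
  "christoffel G k i j x = (\<Sum>l\<in>UNIV. matrix_inv (G x) $ k $ l *
     (partial i (\<lambda>y. G y $ j $ l) x + partial j (\<lambda>y. G y $ i $ l) x
        - partial l (\<lambda>y. G y $ i $ j) x)) / 2"

text \<open>\<open>riemann G l k i j\<close> is the \<open>l\<close>-th component of \<open>R(\<partial>\<^sub>i, \<partial>\<^sub>j) \<partial>\<^sub>k\<close>, with the convention
  \<open>R(X, Y) Z = \<nabla>\<^sub>X \<nabla>\<^sub>Y Z - \<nabla>\<^sub>Y \<nabla>\<^sub>X Z - \<nabla>\<^bsub>[X, Y]\<^esub> Z\<close>; \<open>ricci G j k\<close> is the trace of
  \<open>X \<mapsto> R(X, \<partial>\<^sub>j) \<partial>\<^sub>k\<close>, so that round spheres have positive Ricci curvature.\<close>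

definition riemann ::
  "(real^'n::finite \<Rightarrow> real^'n^'n) \<Rightarrow> 'n \<Rightarrow> 'n \<Rightarrow> 'n \<Rightarrow> 'n \<Rightarrow> real^'n \<Rightarrow> real" where
  "riemann G l k i j x =
     partial i (christoffel G l j k) x - partial j (christoffel G l i k) x
     + (\<Sum>m\<in>UNIV. christoffel G l i m x * christoffel G m j k x
                - christoffel G l j m x * christoffel G m i k x)"

definition ricci ::
  "(real^'n::finite \<Rightarrow> real^'n^'n) \<Rightarrow> 'n \<Rightarrow> 'n \<Rightarrow> real^'n \<Rightarrow> real" where
  "ricci G j k x = (\<Sum>i\<in>UNIV. riemann G i k i j x)"

definition scalar_curvature ::
  "(real^'n::finite \<Rightarrow> real^'n^'n) \<Rightarrow> real^'n \<Rightarrow> real" where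
  "scalar_curvature G x = (\<Sum>j\<in>UNIV. \<Sum>k\<in>UNIV. matrix_inv (G x) $ j $ k * ricci G j k x)"

definition hessian ::
  "(real^'n::finite \<Rightarrow> real^'n^'n) \<Rightarrow> (real^'n \<Rightarrow> real) \<Rightarrow> 'n \<Rightarrow> 'n \<Rightarrow> real^'n \<Rightarrow> real" where
  "hessian G f i j x =
     partial i (partial j f) x - (\<Sum>k\<in>UNIV. christoffel G k i j x * partial k f x)"

definition zero_scalar_curvature :: "('a, 'n::finite) chart set \<Rightarrow> ('a, 'n) metric \<Rightarrow> bool" where
  "zero_scalar_curvature A g \<longleftrightarrow> (\<forall>c\<in>A. \<forall>x\<in>chart_image c. scalar_curvature (g c) x = 0)"

definition flat :: "('a, 'n::finite) chart set \<Rightarrow> ('a, 'n) metric \<Rightarrow> bool" where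
  "flat A g \<longleftrightarrow> (\<forall>c\<in>A. \<forall>x\<in>chart_image c. \<forall>l k i j. riemann (g c) l k i j x = 0)"

text \<open>Around every point there are coordinates in which the metric is \<open>\<delta> / \<phi>\<^sup>2\<close>, i.e. every point
  has a neighbourhood conformally diffeomorphic to an open subset of Euclidean space.\<close>

definition locally_conformally_flat ::
  "'a topology \<Rightarrow> ('a, 'n::finite) chart set \<Rightarrow> ('a, 'n) metric \<Rightarrow> bool" where
  "locally_conformally_flat X A g \<longleftrightarrow>
     (\<forall>p\<in>topspace X. \<exists>c\<in>A. p \<in> fst c \<and>
        (\<exists>\<phi>. smooth_on (chart_image c) \<phi> \<and>
             (\<forall>x\<in>chart_image c. \<phi> x > 0 \<and> g c x = (1 / (\<phi> x)\<^sup>2) *\<^sub>R mat 1)))"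

text \<open>The rotation group \<open>SO(n)\<close> acts on \<open>M\<close> by isometries in the way it acts on Euclidean space:
  every point lies in an invariant chart domain on which the action is, in coordinates, the linear
  one (so that the image is a rotation-invariant open set, such as a ball or an annulus) and the
  components of the metric are invariant under the linear action. The group law, smoothness of the
  action and the isometry property follow from the coordinate expression. Thus
  \<open>dt\<^sup>2 + f(t)\<^sup>2 g\<^bsub>S\<^esub>\<close> on \<open>I \<times> S\<^bsup>n-1\<^esup>\<close>, with or without poles, is rotationally symmetric;
  neither completeness nor the existence of a fixed point is required.\<close>

definition rotationally_symmetric ::
  "'a topology \<Rightarrow> ('a, 'n::finite) chart set \<Rightarrow> ('a, 'n) metric \<Rightarrow> bool" where
  "rotationally_symmetric X A g \<longleftrightarrow>
     (\<exists>act :: real^'n^'n \<Rightarrow> 'a \<Rightarrow> 'a.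
        \<forall>p\<in>topspace X. \<exists>c\<in>A. p \<in> fst c \<and>
          (\<forall>Q. rotation_matrix Q \<longrightarrow>
             (\<forall>q\<in>fst c. act Q q \<in> fst c \<and> snd c (act Q q) = Q *v snd c q) \<and>
             (\<forall>x\<in>chart_image c. transpose Q ** g c (Q *v x) ** Q = g c x)))"

section \<open>Gradient rho-Einstein solitons\<close>

definition soliton_equation ::
  "real \<Rightarrow> real \<Rightarrow> ('a, 'n::finite) chart set \<Rightarrow> ('a, 'n) metric \<Rightarrow> ('a \<Rightarrow> real) \<Rightarrow> bool" where
  "soliton_equation \<rho> lam A g h \<longleftrightarrow>
     (\<forall>c\<in>A. \<forall>x\<in>chart_image c. \<forall>i j.
        ricci (g c) i j x + hessian (g c) (h \<circ> chart_inv c) i j x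
          = \<rho> * scalar_curvature (g c) x * g c x $ i $ j + lam * g c x $ i $ j)"

definition gradient_rho_Einstein_soliton ::
  "real \<Rightarrow> ('a, 'n::finite) chart set \<Rightarrow> ('a, 'n) metric \<Rightarrow> bool" where
  "gradient_rho_Einstein_soliton \<rho> A g \<longleftrightarrow>
     (\<exists>h. smooth_function A h \<and> (\<exists>lam. soliton_equation \<rho> lam A g h))"

text \<open>Like being a soliton, being steady is a property of the Riemannian manifold: the soliton
  equation holds with \<open>lam = 0\<close> for some potential. The constant need not be determined by the
  metric: flat Euclidean space satisfies the equation with constant potential and \<open>lam = 0\<close>, but
  also with potential \<open>lam |x|\<^sup>2 / 2\<close> for arbitrary \<open>lam\<close> (Gaussian solitons).\<close>

definition steady_gradient_rho_Einstein_soliton ::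
  "real \<Rightarrow> ('a, 'n::finite) chart set \<Rightarrow> ('a, 'n) metric \<Rightarrow> bool" where
  "steady_gradient_rho_Einstein_soliton \<rho> A g \<longleftrightarrow>
     (\<exists>h. smooth_function A h \<and> soliton_equation \<rho> 0 A g h)"

end

(* With vanishing scalar curvature the equation reads Ric + Hess h = lam g. Taking the trace and the
   divergence gives Ric(grad h) = 0, and the divergence of that identity gives |Ric|^2 = 0. Together
   with local conformal flatness this makes the metric flat, and a flat metric is steady with
   potential 0.

   Where g = phi^-2 delta, let s = |grad phi|^2 / (2 phi); vanishing of the scalar curvature
   means that s = (Laplace phi) / n, and then Ric = (n - 2) / phi * S with S = D^2 phi - s delta.
   So the computation above takes place in the flat coordinates and only involves partial
   derivatives of phi and h; S = 0 kills the whole curvature tensor. Flatness is carried to the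
   remaining charts by the transformation law of the Christoffel symbols. *)

theory Submission
  imports Defs
begin

section \<open>Partial derivatives\<close>

text \<open>Invariantly, the first divergence uses div Ric = dR/2 = 0 (contracted Bianchi), div Hess
  h = d(Laplace h) + Ric(grad h), and Laplace h = n lam from the trace. The second is div(Ric(grad
  h)) = <Ric, Hess h> = lam R - |Ric|^2 = -|Ric|^2, because Hess h = lam g - Ric. No covariant
  differentiation is set up. In conformal coordinates the Bianchi identity is replaced by S(grad
  phi) = phi grad s, which is the derivative of |grad phi|^2 = 2 phi s, together with the
  differentiated trace of D^2 phi; the commutation rule for the Hessian is replaced by the symmetry
  of third partial derivatives. Both divergences then become algebra in the derivatives at one
  point. Two features of the definitions shape the rest: \<open>flat\<close> speaks of every chart
  of the maximal atlas, while conformal coordinates are given only in some chart around each point;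
  and the constant \<open>lam\<close> of the given potential may be nonzero, so steadiness is
  reached by discarding that potential.\<close>

lemma partial_eqI:
  assumes "(f has_derivative f') (at x)"
  shows "partial i f x = f' (axis i 1)"
  unfolding partial_def using frechet_derivative_at[OF assms] by simp

lemma partial_cong:
  assumes "open S" "x \<in> S" "\<And>y. y \<in> S \<Longrightarrow> f y = g y"
  shows "partial i f x = partial i g x"
proof -
  have "(f has_derivative D) (at x) \<longleftrightarrow> (g has_derivative D) (at x)" for D
    using assms has_derivative_transform_within_open[of f D x UNIV S g]
      has_derivative_transform_within_open[of g D x UNIV S f] by auto
  then show ?thesis unfolding partial_def frechet_derivative_def by simp
qed

lemma has_derivative_partial:
  assumes "f differentiable (at x)"
  shows "(f has_derivative (\<lambda>v. \<Sum>i\<in>UNIV. v $ i * partial i f x)) (at x)"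
proof -
  let ?D = "frechet_derivative f (at x)"
  have D: "(f has_derivative ?D) (at x)" using assms by (simp add: frechet_derivative_works)
  have lin: "linear ?D" using D by (rule has_derivative_linear)
  have "?D v = (\<Sum>i\<in>UNIV. v $ i * partial i f x)" for v
  proof -
    have "?D v = ?D (\<Sum>i\<in>UNIV. v $ i *\<^sub>R axis i 1)"
      by (simp add: basis_expansion flip: scalar_mult_eq_scaleR)
    then show ?thesis by (simp add: linear_sum[OF lin] linear_scale[OF lin] partial_def)
  qed
  then have "?D = (\<lambda>v. \<Sum>i\<in>UNIV. v $ i * partial i f x)" by (rule ext)
  then show ?thesis using D by simp
qed

lemma partial_const [simp]: "partial i (\<lambda>x. c) x = 0"
  by (simp add: partial_def)

context
  fixes f g :: "real^'n::finite \<Rightarrow> real" and x :: "real^'n"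
  assumes f: "f differentiable (at x)" and g: "g differentiable (at x)"
begin

lemmas df = f[unfolded frechet_derivative_works] g[unfolded frechet_derivative_works]

lemma partial_add: "partial i (\<lambda>x. f x + g x) x = partial i f x + partial i g x"
  using partial_eqI[OF has_derivative_add[OF df]] by (simp add: partial_def)

lemma partial_diff: "partial i (\<lambda>x. f x - g x) x = partial i f x - partial i g x"
  using partial_eqI[OF has_derivative_diff[OF df]] by (simp add: partial_def)

lemma partial_mult: "partial i (\<lambda>x. f x * g x) x = f x * partial i g x + partial i f x * g x"
  using partial_eqI[OF has_derivative_mult[OF df]] by (simp add: partial_def)

lemma partial_divide:
  assumes "g x \<noteq> 0"
  shows "partial i (\<lambda>x. f x / g x) x = partial i f x / g x - f x * partial i g x / (g x)\<^sup>2"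
  using partial_eqI[OF has_derivative_divide[OF df assms]]
  by (simp add: partial_def field_simps power2_eq_square assms)

end

lemma partial_sum:
  assumes "\<And>k. k \<in> K \<Longrightarrow> (f k :: real^'n::finite \<Rightarrow> real) differentiable (at x)"
  shows "partial i (\<lambda>x. \<Sum>k\<in>K. f k x) x = (\<Sum>k\<in>K. partial i (f k) x)"
  by (subst partial_eqI, rule has_derivative_sum)
     (use assms in \<open>auto simp: partial_def frechet_derivative_works\<close>)

lemma differentiable_vec_iff:
  fixes y :: "real^'n::finite \<Rightarrow> real^'m::finite"
  shows "y differentiable (at x) \<longleftrightarrow> (\<forall>a. (\<lambda>x. y x $ a) differentiable (at x))"
  by (simp add: differentiable_componentwise_within[of y] Basis_vec_def inner_axis)

lemma partial_compose:
  fixes y :: "real^'n::finite \<Rightarrow> real^'m::finite" and f :: "real^'m \<Rightarrow> real"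
  assumes f: "f differentiable (at (y x))" and y: "y differentiable (at x)"
  shows "partial i (\<lambda>x. f (y x)) x = (\<Sum>a\<in>UNIV. partial i (\<lambda>x. y x $ a) x * partial a f (y x))"
proof -
  obtain D where D: "(y has_derivative D) (at x)" using y by (auto simp: differentiable_def)
  have "partial i (\<lambda>x. y x $ a) x = D (axis i 1) $ a" for a
    using bounded_linear.has_derivative[OF bounded_linear_vec_nth D] by (rule partial_eqI)
  then show ?thesis
    using partial_eqI[OF has_derivative_compose[OF D has_derivative_partial[OF f]]] by simp
qed

section \<open>Consequences of smoothness, up to the symmetry of second partial derivatives\<close>

lemma smooth_on_differentiable:
  assumes "smooth_on S f" "x \<in> S"
  shows "f differentiable (at x)"
  using assms(1)[unfolded smooth_on_def, rule_format, of 1] assms(2) by simp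

lemma smooth_on_partial:
  assumes "smooth_on S f"
  shows "smooth_on S (partial i f)"
  unfolding smooth_on_def
proof
  fix k show "Ck_on k S (partial i f)"
    using assms[unfolded smooth_on_def, rule_format, of "Suc k"] by simp
qed

lemma smooth_on_continuous: "smooth_on S f \<Longrightarrow> continuous_on S f"
  by (metis Ck_on.simps(1) smooth_on_def)

lemma sum_axis: "(\<Sum>k\<in>UNIV. axis i 1 $ k * c k) = (c i :: real)"
  by (simp add: axis_def if_distribR if_distrib[of "\<lambda>u. u * _"] cong: if_cong)

lemma DERIV_partial:
  assumes "f differentiable (at (y + t *\<^sub>R axis i 1))"
  shows "((\<lambda>t. f (y + t *\<^sub>R axis i 1)) has_real_derivative partial i f (y + t *\<^sub>R axis i 1)) (at t)"
proof -
  have "((\<lambda>t. y + t *\<^sub>R axis i 1) has_derivative (\<lambda>s. s *\<^sub>R axis i 1)) (at t)"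
    by (auto intro!: derivative_eq_intros)
  from has_derivative_compose[OF this has_derivative_partial[OF assms]]
  show ?thesis
    by (simp add: has_field_derivative_def mult.assoc sum_axis mult_commute_abs flip: sum_distrib_left)
qed

text \<open>The mean value theorem is applied twice: in direction \<open>i\<close> to the difference
  of \<open>f\<close> and its translate by \<open>h\<close> in direction \<open>j\<close>, then in
  direction \<open>j\<close> to \<open>partial i f\<close>. The second difference is symmetric in
  \<open>i\<close> and \<open>j\<close>, so exchanging them gives a value of the other mixed
  derivative.\<close>

lemma second_difference:
  fixes f :: "real^'n::finite \<Rightarrow> real"
  assumes sub: "cball x (2 * h) \<subseteq> S" and h: "h > 0"
    and f: "\<And>y. y \<in> S \<Longrightarrow> f differentiable (at y)"
    and fi: "\<And>y. y \<in> S \<Longrightarrow> partial i f differentiable (at y)"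
  obtains z where "dist x z \<le> 2 * h"
    "f (x + h *\<^sub>R axis i 1 + h *\<^sub>R axis j 1) - f (x + h *\<^sub>R axis i 1)
      - f (x + h *\<^sub>R axis j 1) + f x = h\<^sup>2 * partial j (partial i f) z"
proof -
  have inS: "x + s *\<^sub>R axis i 1 + t *\<^sub>R axis j 1 \<in> cball x (2 * h)"
    if "0 \<le> s" "s \<le> h" "0 \<le> t" "t \<le> h" for s t
  proof -
    have "dist x (x + s *\<^sub>R axis i 1 + t *\<^sub>R axis j 1) = norm (s *\<^sub>R axis i 1 + t *\<^sub>R axis j 1 :: real^'n)"
      unfolding dist_norm by (metis add.assoc add_diff_cancel_left' norm_minus_commute)
    also have "\<dots> \<le> norm (s *\<^sub>R axis i 1 :: real^'n) + norm (t *\<^sub>R axis j 1 :: real^'n)"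
      by (rule norm_triangle_ineq)
    also have "\<dots> \<le> 2 * h" using that by simp
    finally show ?thesis by simp
  qed
  let ?u = "\<lambda>t. f (x + h *\<^sub>R axis j 1 + t *\<^sub>R axis i 1) - f (x + t *\<^sub>R axis i 1)"
  have "\<exists>t1>0. t1 < h \<and> ?u h - ?u 0 = (h - 0) *
     (partial i f (x + h *\<^sub>R axis j 1 + t1 *\<^sub>R axis i 1) - partial i f (x + t1 *\<^sub>R axis i 1))"
  proof (rule MVT2[OF h])
    fix t assume t: "0 \<le> t" "t \<le> h"
    have "x + h *\<^sub>R axis j 1 + t *\<^sub>R axis i 1 \<in> S" "x + t *\<^sub>R axis i 1 \<in> S"
      using sub inS[of t h] inS[of t 0] t h by (auto simp: add_ac)
    then show "(?u has_real_derivative (partial i f (x + h *\<^sub>R axis j 1 + t *\<^sub>R axis i 1)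
        - partial i f (x + t *\<^sub>R axis i 1))) (at t)"
      by (intro DERIV_diff DERIV_partial f)
  qed
  then obtain t1 where t1: "0 < t1" "t1 < h" and e1: "?u h - ?u 0 = h *
     (partial i f (x + h *\<^sub>R axis j 1 + t1 *\<^sub>R axis i 1) - partial i f (x + t1 *\<^sub>R axis i 1))"
    by auto
  let ?v = "\<lambda>t. partial i f (x + t1 *\<^sub>R axis i 1 + t *\<^sub>R axis j 1)"
  have "\<exists>t2>0. t2 < h \<and> ?v h - ?v 0 = (h - 0) *
      partial j (partial i f) (x + t1 *\<^sub>R axis i 1 + t2 *\<^sub>R axis j 1)"
  proof (rule MVT2[OF h])
    fix t assume t: "0 \<le> t" "t \<le> h"
    have "x + t1 *\<^sub>R axis i 1 + t *\<^sub>R axis j 1 \<in> S"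
      using sub inS[of t1 t] t t1 by auto
    then show "(?v has_real_derivative
        partial j (partial i f) (x + t1 *\<^sub>R axis i 1 + t *\<^sub>R axis j 1)) (at t)"
      by (intro DERIV_partial fi)
  qed
  then obtain t2 where t2: "0 < t2" "t2 < h" and e2: "?v h - ?v 0 = h *
      partial j (partial i f) (x + t1 *\<^sub>R axis i 1 + t2 *\<^sub>R axis j 1)"
    by auto
  show thesis
  proof (rule that[of "x + t1 *\<^sub>R axis i 1 + t2 *\<^sub>R axis j 1"])
    show "dist x (x + t1 *\<^sub>R axis i 1 + t2 *\<^sub>R axis j 1) \<le> 2 * h"
      using inS[of t1 t2] t1 t2 by simp
    show "f (x + h *\<^sub>R axis i 1 + h *\<^sub>R axis j 1) - f (x + h *\<^sub>R axis i 1)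
      - f (x + h *\<^sub>R axis j 1) + f x
      = h\<^sup>2 * partial j (partial i f) (x + t1 *\<^sub>R axis i 1 + t2 *\<^sub>R axis j 1)"
      using e1 e2 by (simp add: power2_eq_square add_ac)
  qed
qed

lemma partial_commute:
  fixes f :: "real^'n::finite \<Rightarrow> real"
  assumes S: "open S" and f: "smooth_on S f" and x: "x \<in> S"
  shows "partial i (partial j f) x = partial j (partial i f) x"
proof (rule ccontr)
  assume ne: "\<not> ?thesis"
  let ?F = "partial i (partial j f)" and ?G = "partial j (partial i f)"
  \<comment> \<open>Half the gap: values within \<open>e\<close> of \<open>?F x\<close> and of
    \<open>?G x\<close> respectively cannot be equal.\<close>
  define e where "e = \<bar>?F x - ?G x\<bar> / 2"
  have e: "e > 0" using ne by (simp add: e_def)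
  have cont: "isCont ?F x" "isCont ?G x"
    using S x smooth_on_continuous[OF smooth_on_partial[OF smooth_on_partial[OF f]]]
    by (auto simp: continuous_on_eq_continuous_at)
  obtain d1 where d1: "d1 > 0" "\<And>z. dist z x < d1 \<Longrightarrow> dist (?F z) (?F x) < e"
    using cont(1) e unfolding continuous_at_eps_delta by blast
  obtain d2 where d2: "d2 > 0" "\<And>z. dist z x < d2 \<Longrightarrow> dist (?G z) (?G x) < e"
    using cont(2) e unfolding continuous_at_eps_delta by blast
  obtain r where r: "r > 0" "cball x r \<subseteq> S" using S x open_contains_cball by blast
  \<comment> \<open>The intermediate points are only known to lie within \<open>2 * h\<close> of
    \<open>x\<close>; dividing by 4 keeps them strictly inside both continuity radii and inside
    \<open>S\<close>.\<close>
  define h where "h = min (min d1 d2) r / 4"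
  have h: "h > 0" "2 * h < d1" "2 * h < d2" "2 * h \<le> r" using d1 d2 r by (auto simp: h_def)
  have sub: "cball x (2 * h) \<subseteq> S" using r h(4) by (meson dual_order.trans subset_cball)
  note D = smooth_on_differentiable[OF f] smooth_on_differentiable[OF smooth_on_partial[OF f]]
  obtain z1 where z1: "dist x z1 \<le> 2 * h" and e1:
    "f (x + h *\<^sub>R axis i 1 + h *\<^sub>R axis j 1) - f (x + h *\<^sub>R axis i 1)
      - f (x + h *\<^sub>R axis j 1) + f x = h\<^sup>2 * ?G z1"
    using second_difference[OF sub h(1) D, of i j] by blast
  obtain z2 where z2: "dist x z2 \<le> 2 * h" and e2:
    "f (x + h *\<^sub>R axis j 1 + h *\<^sub>R axis i 1) - f (x + h *\<^sub>R axis j 1)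
      - f (x + h *\<^sub>R axis i 1) + f x = h\<^sup>2 * ?F z2"
    using second_difference[OF sub h(1) D, of j i] by blast
  have "h\<^sup>2 * ?G z1 = h\<^sup>2 * ?F z2" using e1 e2 by (simp add: algebra_simps)
  then have "?G z1 = ?F z2" using h(1) by simp
  moreover have "dist (?G z1) (?G x) < e" "dist (?F z2) (?F x) < e"
    using d1(2)[of z2] d2(2)[of z1] z1 z2 h by (auto simp: dist_commute)
  ultimately show False unfolding e_def dist_real_def by argo
qed

section \<open>Curvature of conformally flat metrics\<close>

definition kron :: "'n \<Rightarrow> 'n \<Rightarrow> real" where
  "kron i j = (if i = j then 1 else 0)"

lemma kron_same [simp]: "kron i i = 1"
  by (simp add: kron_def)

lemma kron_commute: "kron i j = kron j i"
  by (simp add: kron_def)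

lemma sum_kron [simp]:
  fixes i :: "'n::finite"
  shows "(\<Sum>k\<in>UNIV. kron i k * f k) = f i" "(\<Sum>k\<in>UNIV. kron k i * f k) = f i"
    "(\<Sum>k\<in>UNIV. f k * kron i k) = f i" "(\<Sum>k\<in>UNIV. f k * kron k i) = f i"
  by (simp_all add: kron_def if_distrib[of "\<lambda>u. u * _"] if_distrib[of "\<lambda>u. _ * u"] cong: if_cong)

lemma matrix_inv_eqI:
  fixes M N :: "real^'n^'n"
  assumes "M ** N = mat 1" "N ** M = mat 1"
  shows "matrix_inv M = N"
proof -
  have "M ** matrix_inv M = mat 1 \<and> matrix_inv M ** M = mat 1"
    unfolding matrix_inv_def by (rule someI[of _ N]) (use assms in simp)
  then show ?thesis using assms by (metis matrix_mul_assoc matrix_mul_lid matrix_mul_rid)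
qed

locale conformal_metric =
  fixes U :: "(real^'n::finite) set" and \<phi> :: "real^'n \<Rightarrow> real" and G :: "real^'n \<Rightarrow> real^'n^'n"
  assumes open_U: "open U"
    and smooth: "smooth_on U \<phi>"
    and pos: "x \<in> U \<Longrightarrow> \<phi> x > 0"
    and metric: "x \<in> U \<Longrightarrow> G x = (1 / (\<phi> x)\<^sup>2) *\<^sub>R mat 1"
begin

text \<open>The gradient of log phi. For g = e^(2u) delta with u = - log phi this is -du, and the
  Christoffel symbols are linear in it.\<close>

definition dlog :: "'n \<Rightarrow> real^'n \<Rightarrow> real" where
  "dlog i x = partial i \<phi> x / \<phi> x"

definition dlog_sq :: "real^'n \<Rightarrow> real" where
  "dlog_sq x = (\<Sum>i\<in>UNIV. (dlog i x)\<^sup>2)"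

lemma nz: "x \<in> U \<Longrightarrow> \<phi> x \<noteq> 0"
  using pos by force

lemma differentiable: "x \<in> U \<Longrightarrow> \<phi> differentiable (at x)"
  by (rule smooth_on_differentiable[OF smooth])

lemma differentiable_partial: "x \<in> U \<Longrightarrow> partial i \<phi> differentiable (at x)"
  by (rule smooth_on_differentiable[OF smooth_on_partial[OF smooth]])

lemma metric_inv: "x \<in> U \<Longrightarrow> matrix_inv (G x) = (\<phi> x)\<^sup>2 *\<^sub>R mat 1"
  using nz by (intro matrix_inv_eqI) (auto simp: metric scalar_matrix_assoc[symmetric] matrix_scalar_ac)

lemma invertible_metric: "x \<in> U \<Longrightarrow> invertible (G x)"
  unfolding invertible_def using nz
  by (intro exI[of _ "(\<phi> x)\<^sup>2 *\<^sub>R mat 1"]) (auto simp: metric scalar_matrix_assoc[symmetric] matrix_scalar_ac)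

lemma partial_metric:
  assumes x: "x \<in> U"
  shows "partial i (\<lambda>y. G y $ j $ l) x = - 2 * kron j l * partial i \<phi> x / (\<phi> x) ^ 3"
proof -
  have "partial i (\<lambda>y. G y $ j $ l) x = partial i (\<lambda>y. kron j l / (\<phi> y * \<phi> y)) x"
    by (rule partial_cong[OF open_U x]) (auto simp: metric mat_def kron_def power2_eq_square)
  also have "\<dots> = - 2 * kron j l * partial i \<phi> x / (\<phi> x) ^ 3"
    using nz[OF x] differentiable[OF x]
    by (simp add: partial_divide partial_mult field_simps power2_eq_square power3_eq_cube)
  finally show ?thesis .
qed

lemma christoffel_conformal:
  assumes x: "x \<in> U"
  shows "christoffel G k i j x = kron i j * dlog k x - kron k i * dlog j x - kron k j * dlog i x"
proof -
  have "christoffel G k i j x = (\<Sum>l\<in>UNIV. kron k l * ((\<phi> x)\<^sup>2 *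
     (- 2 * kron j l * partial i \<phi> x / (\<phi> x) ^ 3 - 2 * kron i l * partial j \<phi> x / (\<phi> x) ^ 3
        + 2 * kron i j * partial l \<phi> x / (\<phi> x) ^ 3))) / 2"
    unfolding christoffel_def metric_inv[OF x] partial_metric[OF x]
    by (intro arg_cong[where f="\<lambda>u. u / 2"] sum.cong) (auto simp: mat_def kron_def)
  also have "\<dots> = kron i j * dlog k x - kron k i * dlog j x - kron k j * dlog i x"
    unfolding sum_kron dlog_def using nz[OF x]
    by (simp add: field_simps power2_eq_square power3_eq_cube kron_commute)
  finally show ?thesis .
qed

lemma differentiable_dlog: "x \<in> U \<Longrightarrow> dlog i differentiable (at x)"
  unfolding dlog_def[abs_def]
  by (intro differentiable_divide differentiable differentiable_partial nz)

lemma partial_dlog: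
  assumes x: "x \<in> U"
  shows "partial i (dlog j) x = partial i (partial j \<phi>) x / \<phi> x - dlog i x * dlog j x"
  unfolding dlog_def[abs_def]
  using partial_divide[OF differentiable_partial[OF x] differentiable[OF x] nz[OF x]]
  by (simp add: power2_eq_square)

lemma partial_christoffel_conformal:
  assumes x: "x \<in> U"
  shows "partial p (christoffel G k i j) x
    = kron i j * partial p (dlog k) x - kron k i * partial p (dlog j) x - kron k j * partial p (dlog i) x"
proof -
  have "partial p (christoffel G k i j) x
    = partial p (\<lambda>x. kron i j * dlog k x - kron k i * dlog j x - kron k j * dlog i x) x"
    by (rule partial_cong[OF open_U x]) (rule christoffel_conformal)
  then show ?thesis
    using differentiable_dlog[OF x] by (simp add: partial_diff partial_mult)
qed

lemma differentiable_christoffel: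
  assumes x: "x \<in> U"
  shows "christoffel G k i j differentiable (at x)"
proof -
  have "(\<lambda>x. kron i j * dlog k x - kron k i * dlog j x - kron k j * dlog i x) differentiable (at x)"
    using differentiable_dlog[OF x] by simp
  then obtain D where
    "((\<lambda>x. kron i j * dlog k x - kron k i * dlog j x - kron k j * dlog i x) has_derivative D) (at x)"
    by (auto simp: differentiable_def)
  then have "(christoffel G k i j has_derivative D) (at x)"
    by (rule has_derivative_transform_within_open[OF _ open_U x]) (simp add: christoffel_conformal)
  then show ?thesis by (auto simp: differentiable_def)
qed

text \<open>Evaluates the quadratic terms of \<open>riemann\<close> in two moves: the left factor is
  expanded against an arbitrary \<open>X\<close>, and the one sum that remains is then given by
  \<open>dlog_christoffel\<close>.\<close>

lemma christoffel_contract: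
  assumes x: "x \<in> U"
  shows "(\<Sum>m\<in>UNIV. christoffel G l i m x * X m)
    = dlog l x * X i - kron l i * (\<Sum>m\<in>UNIV. dlog m x * X m) - dlog i x * X l"
proof -
  have "(\<Sum>m\<in>UNIV. christoffel G l i m x * X m)
    = (\<Sum>m\<in>UNIV. kron i m * (dlog l x * X m) - kron l i * (dlog m x * X m) - kron l m * (dlog i x * X m))"
    by (simp add: christoffel_conformal[OF x] algebra_simps)
  then show ?thesis by (simp add: sum_subtractf flip: sum_distrib_left)
qed

lemma dlog_christoffel:
  assumes x: "x \<in> U"
  shows "(\<Sum>m\<in>UNIV. dlog m x * christoffel G m j k x) = kron j k * dlog_sq x - 2 * dlog j x * dlog k x"
proof -
  have "(\<Sum>m\<in>UNIV. dlog m x * christoffel G m j k x)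
    = (\<Sum>m\<in>UNIV. kron j k * (dlog m x)\<^sup>2 - kron m j * (dlog m x * dlog k x) - kron m k * (dlog m x * dlog j x))"
    by (simp add: christoffel_conformal[OF x] algebra_simps power2_eq_square)
  then show ?thesis by (simp add: sum_subtractf dlog_sq_def flip: sum_distrib_left)
qed

text \<open>The products of \<open>dlog\<close> terms coming from \<open>partial_dlog\<close> cancel
  against those from the quadratic Christoffel terms; only the Hessian of phi and
  \<open>dlog_sq\<close> survive, which is the benefit of writing the factor as phi^-2. The result
  is the Kulkarni-Nomizu type product of delta with \<open>b - dlog_sq / 2\<close> times delta, so
  it vanishes when the latter does.\<close>

lemma riemann_conformal:
  assumes x: "x \<in> U"
  defines "b \<equiv> \<lambda>i j. partial i (partial j \<phi>) x / \<phi> x"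
  shows "riemann G l k i j x = kron l i * b j k - kron l j * b i k + kron j k * b i l - kron i k * b j l
    - (kron l i * kron j k - kron l j * kron i k) * dlog_sq x"
proof -
  have b: "partial i (dlog j) x = b i j - dlog i x * dlog j x" for i j
    using partial_dlog[OF x] by (simp add: b_def)
  have b_sym: "b i j = b j i" for i j
    by (simp add: b_def partial_commute[OF open_U smooth x, of i j])
  have "riemann G l k i j x = partial i (christoffel G l j k) x - partial j (christoffel G l i k) x
     + ((\<Sum>m\<in>UNIV. christoffel G l i m x * christoffel G m j k x)
       - (\<Sum>m\<in>UNIV. christoffel G l j m x * christoffel G m i k x))"
    by (simp add: riemann_def sum_subtractf)
  then show ?thesis
    unfolding christoffel_contract[OF x] dlog_christoffel[OF x] partial_christoffel_conformal[OF x] b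
    unfolding christoffel_conformal[OF x]
    by (simp add: algebra_simps kron_commute[of i l] kron_commute[of j l] kron_commute[of j i]
       kron_commute[of k i] kron_commute[of k j] kron_commute[of k l] b_sym[of j i])
qed

lemma ricci_conformal:
  assumes x: "x \<in> U"
  defines "b \<equiv> \<lambda>i j. partial i (partial j \<phi>) x / \<phi> x"
  shows "ricci G j k x = (real CARD('n) - 2) * b j k
    + kron j k * ((\<Sum>i\<in>UNIV. b i i) - (real CARD('n) - 1) * dlog_sq x)"
proof -
  have b_sym: "b i j = b j i" for i j
    by (simp add: b_def partial_commute[OF open_U smooth x, of i j])
  have "ricci G j k x = (\<Sum>i\<in>UNIV. b j k - kron i j * b i k + kron j k * b i i - kron i k * b j i
    - kron j k * dlog_sq x + kron i j * (kron i k * dlog_sq x))"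
    unfolding ricci_def riemann_conformal[OF x] b_def by (intro sum.cong) (auto simp: algebra_simps)
  also have "\<dots> = (real CARD('n) - 2) * b j k
    + kron j k * ((\<Sum>i\<in>UNIV. b i i) - (real CARD('n) - 1) * dlog_sq x)"
    by (simp add: sum.distrib sum_subtractf algebra_simps flip: sum_distrib_left)
  finally show ?thesis .
qed

lemma scalar_curvature_conformal:
  assumes x: "x \<in> U"
  shows "scalar_curvature G x = (real CARD('n) - 1) * (\<phi> x)\<^sup>2 *
    (2 * (\<Sum>i\<in>UNIV. partial i (partial i \<phi>) x / \<phi> x) - real CARD('n) * dlog_sq x)"
proof -
  define b where "b = (\<lambda>i j. partial i (partial j \<phi>) x / \<phi> x)"
  have "scalar_curvature G x = (\<Sum>j\<in>UNIV. \<Sum>k\<in>UNIV. kron j k * ((\<phi> x)\<^sup>2 * ricci G j k x))"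
    unfolding scalar_curvature_def metric_inv[OF x]
    by (intro sum.cong) (auto simp: mat_def kron_def)
  also have "\<dots> = (\<Sum>j\<in>UNIV. (\<phi> x)\<^sup>2 * ((real CARD('n) - 2) * b j j
      + ((\<Sum>i\<in>UNIV. b i i) - (real CARD('n) - 1) * dlog_sq x)))"
    by (simp add: ricci_conformal[OF x] b_def)
  also have "\<dots> = (\<phi> x)\<^sup>2 * ((real CARD('n) - 2) * (\<Sum>i\<in>UNIV. b i i)
      + real CARD('n) * ((\<Sum>i\<in>UNIV. b i i) - (real CARD('n) - 1) * dlog_sq x))"
    by (simp add: sum.distrib flip: sum_distrib_left)
  also have "\<dots> = (real CARD('n) - 1) * (\<phi> x)\<^sup>2 * (2 * (\<Sum>i\<in>UNIV. b i i) - real CARD('n) * dlog_sq x)"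
    by (simp add: algebra_simps)
  finally show ?thesis by (simp add: b_def)
qed

lemma hessian_conformal:
  assumes x: "x \<in> U"
  shows "hessian G f i j x = partial i (partial j f) x + dlog i x * partial j f x + dlog j x * partial i f x
    - kron i j * (\<Sum>k\<in>UNIV. dlog k x * partial k f x)"
proof -
  have "(\<Sum>k\<in>UNIV. christoffel G k i j x * partial k f x) = (\<Sum>k\<in>UNIV. kron i j * (dlog k x * partial k f x)
    - kron k i * (dlog j x * partial k f x) - kron k j * (dlog i x * partial k f x))"
    by (simp add: christoffel_conformal[OF x] algebra_simps)
  then show ?thesis
    by (simp add: hessian_def sum_subtractf flip: sum_distrib_left)
qed

end

section \<open>Scalar-flat solitons in conformal coordinates\<close>

text \<open>The next two lemmas are pointwise: \<open>p0, p1, p2, p3\<close> are the values of \<open>\<phi>\<close> and its partial derivatives,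
  \<open>h1, h2, h3\<close> those of the derivatives of the potential, \<open>s1\<close> is the gradient of \<open>s\<close>, \<open>E\<close> is the
  soliton equation times \<open>\<phi>\<close>, and \<open>dE\<close> its derivative in direction \<open>k\<close>. The first lemma combines the
  divergence of \<open>E\<close>, the derivative of its trace, and its contraction with \<open>\<nabla>\<phi>\<close>.\<close>

lemma soliton_divergence:
  fixes p1 h1 s1 :: "'n::finite \<Rightarrow> real" and p2 h2 :: "'n \<Rightarrow> 'n \<Rightarrow> real"
    and p3 h3 :: "'n \<Rightarrow> 'n \<Rightarrow> 'n \<Rightarrow> real" and p0 s lam n :: real
  assumes n: "n = real CARD('n)" "n \<noteq> 2" and p0: "p0 \<noteq> 0"
    and sym: "\<And>i j. p2 i j = p2 j i" "\<And>i j. h2 i j = h2 j i"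
      "\<And>i j. p3 i i j = p3 j i i" "\<And>i j. h3 i i j = h3 j i i"
    and P: "(\<Sum>i\<in>UNIV. (p1 i)\<^sup>2) = 2 * p0 * s"
    and L: "(\<Sum>i\<in>UNIV. p2 i i) = n * s"
    and L1: "\<And>j. (\<Sum>i\<in>UNIV. p3 j i i) = n * s1 j"
    and S1: "\<And>j. (\<Sum>i\<in>UNIV. p2 i j * p1 i) = p0 * s1 j + p1 j * s"
    and E: "\<And>i j. (n - 2) * (p2 i j - kron i j * s) + p0 * h2 i j + p1 i * h1 j + p1 j * h1 i
      - kron i j * ((\<Sum>l\<in>UNIV. p1 l * h1 l) + lam / p0) = 0"
    and dE: "\<And>k i j. (n - 2) * (p3 k i j - kron i j * s1 k) + p1 k * h2 i j + p0 * h3 k i j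
      + p2 k i * h1 j + p1 i * h2 k j + p2 k j * h1 i + p1 j * h2 k i
      - kron i j * ((\<Sum>l\<in>UNIV. p2 l k * h1 l) + (\<Sum>l\<in>UNIV. p1 l * h2 l k) - lam / p0\<^sup>2 * p1 k) = 0"
  shows "(\<Sum>i\<in>UNIV. (p2 i j - kron i j * s) * h1 i) = 0"
proof -
  define a where "a = (\<Sum>i\<in>UNIV. p1 i * h2 i j)"
  define b where "b = (\<Sum>i\<in>UNIV. p2 i j * h1 i)"
  define H where "H = (\<Sum>i\<in>UNIV. h3 j i i)"
  define K where "K = (\<Sum>i\<in>UNIV. h2 i i)"
  \<comment> \<open>\<open>A\<close> is \<open>dE\<close> with \<open>k = i\<close>, summed over
    \<open>i\<close>. The symmetry of third derivatives turns \<open>p3 i i j\<close> and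
    \<open>h3 i i j\<close> into derivatives of traces, the same ones that occur in
    \<open>B\<close>.\<close>
  have "(\<Sum>i\<in>UNIV. (n - 2) * p3 j i i - kron i j * ((n - 2) * s1 i) + p1 i * h2 i j + p0 * h3 j i i
      + p2 i i * h1 j + p1 i * h2 i j + p2 i j * h1 i + p1 j * h2 i i
      - kron i j * ((\<Sum>l\<in>UNIV. p2 l i * h1 l) + (\<Sum>l\<in>UNIV. p1 l * h2 l i) - lam / p0\<^sup>2 * p1 i)) = 0"
  proof (intro sum.neutral ballI, goal_cases)
    case (1 i)
    then show ?case using dE[of i i j] by (simp add: sym(3)[of i j] sym(4)[of i j] algebra_simps)
  qed
  then have A: "(n - 2) * (n * s1 j) - (n - 2) * s1 j + a + p0 * H + n * s * h1 j + a + b + p1 j * K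
      - (b + a - lam / p0\<^sup>2 * p1 j) = 0"
    by (simp add: sum.distrib sum_subtractf L L1 a_def b_def H_def K_def flip: sum_distrib_left sum_distrib_right)
  \<comment> \<open>\<open>B\<close> is the derivative of the trace of \<open>E\<close> in direction
    \<open>j\<close>. \<open>H\<close> and \<open>K\<close> have the same coefficients here as in
    \<open>A\<close>.\<close>
  have "(\<Sum>i\<in>UNIV. (n - 2) * p3 j i i - (n - 2) * s1 j + p1 j * h2 i i + p0 * h3 j i i
      + 2 * (p2 i j * h1 i) + 2 * (p1 i * h2 i j) - (b + a - lam / p0\<^sup>2 * p1 j)) = 0"
  proof (intro sum.neutral ballI, goal_cases)
    case (1 i)
    then show ?case using dE[of j i i] by (simp add: sym(1,2)[of j] a_def b_def algebra_simps)
  qed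
  then have B: "(n - 2) * (n * s1 j) - n * ((n - 2) * s1 j) + p1 j * K + p0 * H + 2 * b + 2 * a
      - n * (b + a - lam / p0\<^sup>2 * p1 j) = 0"
    by (simp add: sum.distrib sum_subtractf L1 H_def K_def n(1)[symmetric] flip: sum_distrib_left sum_distrib_right)
       (simp add: a_def b_def)
  \<comment> \<open>\<open>C\<close> is \<open>E\<close> contracted with grad phi and divided by
    \<open>p0\<close>; \<open>S1\<close> and \<open>P\<close> remove the contractions of phi with
    itself.\<close>
  have "(\<Sum>i\<in>UNIV. (n - 2) * (p2 i j * p1 i) - kron i j * ((n - 2) * s * p1 i) + p0 * (p1 i * h2 i j)
      + (p1 i)\<^sup>2 * h1 j + p1 j * (p1 i * h1 i) - kron i j * (p1 i * ((\<Sum>l\<in>UNIV. p1 l * h1 l) + lam / p0))) = 0"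
  proof (intro sum.neutral ballI, goal_cases)
    case (1 i)
    have "p1 i * ((n - 2) * (p2 i j - kron i j * s) + p0 * h2 i j + p1 i * h1 j + p1 j * h1 i
      - kron i j * ((\<Sum>l\<in>UNIV. p1 l * h1 l) + lam / p0)) = 0"
      unfolding E by simp
    then show ?case by (simp add: algebra_simps power2_eq_square)
  qed
  then have "(n - 2) * (p0 * s1 j + p1 j * s) - (n - 2) * s * p1 j + p0 * a + 2 * p0 * s * h1 j
      + p1 j * (\<Sum>l\<in>UNIV. p1 l * h1 l) - p1 j * ((\<Sum>l\<in>UNIV. p1 l * h1 l) + lam / p0) = 0"
    by (simp add: sum.distrib sum_subtractf S1 P a_def flip: sum_distrib_left sum_distrib_right)
  then have "p0 * ((n - 2) * s1 j + a + 2 * s * h1 j - lam / p0\<^sup>2 * p1 j) = 0"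
    using p0 by (simp add: field_simps power2_eq_square)
  then have C: "(n - 2) * s1 j + a + 2 * s * h1 j - lam / p0\<^sup>2 * p1 j = 0"
    using p0 by simp
  \<comment> \<open>In \<open>A\<close> minus \<open>B\<close> the terms in \<open>s1\<close>,
    \<open>a\<close> and \<open>lam\<close> are \<open>n - 1\<close> times those of
    \<open>C\<close>. After subtracting them, \<open>s * h1 j\<close> is left with coefficient
    \<open>n - 2 * (n - 1) = - (n - 2)\<close>, matching that of \<open>b\<close>.\<close>
  have "(n - 2) * (b - s * h1 j)
    = ((n - 2) * (n * s1 j) - (n - 2) * s1 j + a + p0 * H + n * s * h1 j + a + b + p1 j * K
      - (b + a - lam / p0\<^sup>2 * p1 j))
      - ((n - 2) * (n * s1 j) - n * ((n - 2) * s1 j) + p1 j * K + p0 * H + 2 * b + 2 * a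
      - n * (b + a - lam / p0\<^sup>2 * p1 j))
      - (n - 1) * ((n - 2) * s1 j + a + 2 * s * h1 j - lam / p0\<^sup>2 * p1 j)"
    by (simp add: algebra_simps flip: add_divide_distrib diff_divide_distrib)
  then have "b = s * h1 j" unfolding A B C using n(2) by simp
  then show ?thesis by (simp add: b_def left_diff_distrib sum_subtractf mult.assoc)
qed

lemma soliton_traceless_zero:
  fixes p1 h1 s1 :: "'n::finite \<Rightarrow> real" and p2 h2 :: "'n \<Rightarrow> 'n \<Rightarrow> real"
    and p3 :: "'n \<Rightarrow> 'n \<Rightarrow> 'n \<Rightarrow> real" and p0 s t n :: real
  assumes n: "n = real CARD('n)" "n > 2" and p0: "p0 \<noteq> 0"
    and sym: "\<And>i j. p2 i j = p2 j i" "\<And>i j. h2 i j = h2 j i" "\<And>i j. p3 i j i = p3 j i i"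
    and L: "(\<Sum>i\<in>UNIV. p2 i i) = n * s"
    and L1: "\<And>j. (\<Sum>i\<in>UNIV. p3 j i i) = n * s1 j"
    and S1: "\<And>j. (\<Sum>i\<in>UNIV. p2 i j * p1 i) = p0 * s1 j + p1 j * s"
    and E: "\<And>i j. (n - 2) * (p2 i j - kron i j * s) + p0 * h2 i j + p1 i * h1 j + p1 j * h1 i
      - kron i j * t = 0"
    and V: "\<And>j. (\<Sum>i\<in>UNIV. (p2 i j - kron i j * s) * h1 i) = 0"
    and dV: "\<And>k j. (\<Sum>i\<in>UNIV. (p2 i j - kron i j * s) * h2 k i + (p3 k i j - kron i j * s1 k) * h1 i) = 0"
  shows "p2 i j = kron i j * s"
proof -
  define S where "S = (\<lambda>i j. p2 i j - kron i j * s)"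
  have S_sym: "S i j = S j i" for i j by (simp add: S_def sym(1)[of i] kron_commute)
  \<comment> \<open>S(grad phi) = phi grad s. Pairing with grad h and using S(grad h) = 0 makes grad
    s orthogonal to grad h.\<close>
  have p0s1: "p0 * s1 i = (\<Sum>k\<in>UNIV. S k i * p1 k)" for i
    using S1[of i] by (simp add: S_def left_diff_distrib sum_subtractf mult.assoc)
  have V': "(\<Sum>i\<in>UNIV. S j i * h1 i) = 0" for j using V[of j] by (simp add: S_def sym(1)[of j] kron_commute[of j])
  have "p0 * (\<Sum>i\<in>UNIV. s1 i * h1 i) = (\<Sum>i\<in>UNIV. \<Sum>k\<in>UNIV. S k i * p1 k * h1 i)"
    by (simp add: sum_distrib_left sum_distrib_right p0s1 flip: mult.assoc)
  also have "\<dots> = (\<Sum>k\<in>UNIV. p1 k * (\<Sum>i\<in>UNIV. S k i * h1 i))"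
    by (subst sum.swap) (simp add: sum_distrib_left mult_ac)
  finally have s1h1: "(\<Sum>i\<in>UNIV. s1 i * h1 i) = 0" using p0 by (simp add: V')
  \<comment> \<open>The divergence of S(grad h) = 0: it reads <S, D^2 h> + (n - 1) <grad s, grad h>
    = 0, so the orthogonality just shown gives <S, D^2 h> = 0.\<close>
  have "0 = (\<Sum>j\<in>UNIV. \<Sum>i\<in>UNIV. S i j * h2 j i + (p3 j i j - kron i j * s1 j) * h1 i)"
    by (simp add: dV S_def)
  also have "\<dots> = (\<Sum>j\<in>UNIV. \<Sum>i\<in>UNIV. S i j * h2 j i) + (\<Sum>i\<in>UNIV. \<Sum>j\<in>UNIV. p3 j i j * h1 i)
      - (\<Sum>j\<in>UNIV. s1 j * h1 j)"
    by (subst (3) sum.swap) (simp add: sum.distrib left_diff_distrib sum_subtractf mult.assoc)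
  also have "(\<Sum>i\<in>UNIV. \<Sum>j\<in>UNIV. p3 j i j * h1 i) = n * (\<Sum>i\<in>UNIV. s1 i * h1 i)"
    by (simp add: sym(3) L1 sum_distrib_left mult.assoc flip: sum_distrib_right)
  finally have Sh: "(\<Sum>j\<in>UNIV. \<Sum>i\<in>UNIV. S i j * h2 i j) = 0" by (simp add: s1h1 sym(2))
  \<comment> \<open>\<open>E\<close> contracted with \<open>S\<close>. The Hessian term is zero by
    \<open>Sh\<close>, the mixed terms by S(grad h) = 0, and the multiple \<open>t\<close> of delta
    because \<open>S\<close> is trace-free; only \<open>n - 2\<close> times |S|^2 remains.\<close>
  have "0 = (\<Sum>j\<in>UNIV. \<Sum>i\<in>UNIV. S i j * ((n - 2) * S i j + p0 * h2 i j + p1 i * h1 j + p1 j * h1 i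
      - kron i j * t))"
    by (simp add: E S_def)
  also have "\<dots> = (\<Sum>j\<in>UNIV. \<Sum>i\<in>UNIV. (n - 2) * (S i j)\<^sup>2 + p0 * (S i j * h2 i j)
      + p1 i * (S i j * h1 j) + p1 j * (S j i * h1 i) - kron i j * (S i j * t))"
    by (intro sum.cong) (auto simp: algebra_simps power2_eq_square S_sym)
  also have "\<dots> = (n - 2) * (\<Sum>j\<in>UNIV. \<Sum>i\<in>UNIV. (S i j)\<^sup>2) + (\<Sum>j\<in>UNIV. \<Sum>i\<in>UNIV. p1 i * (S i j * h1 j))
      - t * (\<Sum>j\<in>UNIV. S j j)"
    by (simp add: sum.distrib sum_subtractf Sh V' mult.commute[of t] flip: sum_distrib_left sum_distrib_right)
  also have "(\<Sum>j\<in>UNIV. \<Sum>i\<in>UNIV. p1 i * (S i j * h1 j)) = 0"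
    by (subst sum.swap) (simp add: V' flip: sum_distrib_left)
  also have "(\<Sum>j\<in>UNIV. S j j) = 0"
    using L n by (simp add: S_def sum_subtractf)
  finally have "(\<Sum>j\<in>UNIV. \<Sum>i\<in>UNIV. (S i j)\<^sup>2) = 0" using n(2) by simp
  then have "S i j = 0"
    by (simp add: sum_nonneg_eq_0_iff sum_nonneg)
  then show ?thesis by (simp add: S_def)
qed

context conformal_metric
begin

text \<open>The identities \<open>L\<close>, \<open>E\<close> and \<open>V\<close> are established
  at every point of the open set \<open>U\<close>, not just at \<open>x\<close>, so that they may be
  differentiated; their derivatives \<open>L1\<close>, \<open>dE\<close> and \<open>dV\<close> are
  the remaining inputs of the two pointwise lemmas.\<close>

lemma scalar_flat_soliton:
  fixes f :: "real^'n \<Rightarrow> real" and lam :: real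
  assumes card: "CARD('n) \<ge> 3" and f: "smooth_on U f"
    and scal: "\<And>x. x \<in> U \<Longrightarrow> scalar_curvature G x = 0"
    and sol: "\<And>x i j. x \<in> U \<Longrightarrow> ricci G i j x + hessian G f i j x = lam * G x $ i $ j"
    and x: "x \<in> U"
  shows "riemann G l k i j x = 0"
proof -
  define n where "n = real CARD('n)"
  have n: "n > 2" using card by (simp add: n_def)
  define s where "s = (\<lambda>y. (\<Sum>i\<in>UNIV. partial i \<phi> y * partial i \<phi> y) / (2 * \<phi> y))"
  let ?p1 = "\<lambda>i. partial i \<phi>" and ?p2 = "\<lambda>i j. partial i (partial j \<phi>)"
    and ?p3 = "\<lambda>k i j. partial k (partial i (partial j \<phi>))"
  let ?h1 = "\<lambda>i. partial i f" and ?h2 = "\<lambda>i j. partial i (partial j f)"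
    and ?h3 = "\<lambda>k i j. partial k (partial i (partial j f))"
  note sm = smooth_on_partial[OF smooth] smooth_on_partial[OF f]
    smooth_on_partial[OF smooth_on_partial[OF smooth]] smooth_on_partial[OF smooth_on_partial[OF f]]
  have p2_sym: "?p2 i j y = ?p2 j i y" if "y \<in> U" for i j y
    using partial_commute[OF open_U smooth that] .
  have h2_sym: "?h2 i j y = ?h2 j i y" if "y \<in> U" for i j y
    using partial_commute[OF open_U f that] .
  have p3_sym: "?p3 k i j y = ?p3 k j i y" "?p3 k i j y = ?p3 i k j y" if y: "y \<in> U" for i j k y
    using partial_cong[OF open_U y, of "?p2 i j" "?p2 j i" k] p2_sym partial_commute[OF open_U sm(1) y] by blast+
  have h3_sym: "?h3 k i j y = ?h3 k j i y" "?h3 k i j y = ?h3 i k j y" if y: "y \<in> U" for i j k y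
    using partial_cong[OF open_U y, of "?h2 i j" "?h2 j i" k] h2_sym partial_commute[OF open_U sm(2) y] by blast+
  have s_eq: "s y = \<phi> y * dlog_sq y / 2" if "y \<in> U" for y
    using nz[OF that] by (simp add: s_def dlog_sq_def dlog_def power_divide power2_eq_square field_simps
        flip: sum_divide_distrib)
  have L: "(\<Sum>i\<in>UNIV. ?p2 i i y) = n * s y" if "y \<in> U" for y
  proof -
    have "2 * (\<Sum>i\<in>UNIV. ?p2 i i y / \<phi> y) = n * dlog_sq y"
      using scal[OF that] nz[OF that] n by (simp add: scalar_curvature_conformal[OF that] n_def)
    then show ?thesis using nz[OF that]
      by (simp add: s_eq[OF that] flip: sum_divide_distrib) (simp add: field_simps)
  qed
  have E: "(n - 2) * (?p2 i j y - kron i j * s y) + \<phi> y * ?h2 i j y + ?p1 i y * ?h1 j y + ?p1 j y * ?h1 i y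
      - kron i j * ((\<Sum>l\<in>UNIV. ?p1 l y * ?h1 l y) + lam / \<phi> y) = 0" if y: "y \<in> U" for i j y
  proof -
    have "(\<Sum>i\<in>UNIV. ?p2 i i y / \<phi> y) = n * dlog_sq y / 2"
      using L[OF y] nz[OF y] by (simp add: s_eq[OF y] flip: sum_divide_distrib)
    then have ric: "ricci G i j y = (n - 2) * (?p2 i j y / \<phi> y) + kron i j * (n * dlog_sq y / 2 - (n - 1) * dlog_sq y)"
      using ricci_conformal[OF y, of i j] by (simp add: n_def)
    have dq: "dlog_sq y = 2 * s y / \<phi> y" using s_eq[OF y] nz[OF y] by (simp add: field_simps)
    have gr: "(\<Sum>k\<in>UNIV. dlog k y * partial k f y) = (\<Sum>l\<in>UNIV. ?p1 l y * ?h1 l y) / \<phi> y"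
      by (simp add: dlog_def sum_divide_distrib)
    have G: "G y $ i $ j = kron i j / (\<phi> y)\<^sup>2" by (simp add: metric[OF y] mat_def kron_def)
    have "ricci G i j y + hessian G f i j y - lam * G y $ i $ j
      = ((n - 2) * (?p2 i j y - kron i j * s y) + \<phi> y * ?h2 i j y + ?p1 i y * ?h1 j y + ?p1 j y * ?h1 i y
      - kron i j * ((\<Sum>l\<in>UNIV. ?p1 l y * ?h1 l y) + lam / \<phi> y)) / \<phi> y"
      unfolding ric hessian_conformal[OF y] gr G dq using nz[OF y]
      by (simp add: dlog_def add_divide_distrib diff_divide_distrib algebra_simps power2_eq_square)
    then show ?thesis using sol[OF y] nz[OF y] by simp
  qed
  note D = smooth_on_differentiable[OF smooth] smooth_on_differentiable[OF f]
    smooth_on_differentiable[OF sm(1)] smooth_on_differentiable[OF sm(2)]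
    smooth_on_differentiable[OF sm(3)] smooth_on_differentiable[OF sm(4)]
  have Ds: "s differentiable (at y)" if y: "y \<in> U" for y
    unfolding s_def using D[OF y] nz[OF y]
    by (intro differentiable_divide differentiable_sum differentiable_mult ballI) auto
  have L1: "(\<Sum>i\<in>UNIV. ?p3 k i i y) = n * partial k s y" if y: "y \<in> U" for k y
  proof -
    have "partial k (\<lambda>y. \<Sum>i\<in>UNIV. ?p2 i i y) y = partial k (\<lambda>y. n * s y) y"
      by (rule partial_cong[OF open_U y L])
    then show ?thesis using D[OF y] Ds[OF y] by (simp add: partial_sum partial_mult)
  qed
  \<comment> \<open>Half the derivative of |grad phi|^2 = 2 phi s.\<close>
  have S1: "(\<Sum>i\<in>UNIV. ?p2 i k y * ?p1 i y) = \<phi> y * partial k s y + ?p1 k y * s y" if y: "y \<in> U" for k y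
  proof -
    have "partial k (\<lambda>y. \<Sum>i\<in>UNIV. ?p1 i y * ?p1 i y) y = partial k (\<lambda>y. 2 * (\<phi> y * s y)) y"
      by (rule partial_cong[OF open_U y]) (use nz in \<open>simp add: s_def\<close>)
    then have "(\<Sum>i\<in>UNIV. 2 * (?p2 k i y * ?p1 i y)) = 2 * (\<phi> y * partial k s y + ?p1 k y * s y)"
      using D[OF y] Ds[OF y] by (simp add: partial_sum partial_mult mult_ac)
    then show ?thesis by (simp add: p2_sym[OF y, of k] flip: sum_distrib_left)
  qed
  have dE: "(n - 2) * (?p3 k i j y - kron i j * partial k s y) + ?p1 k y * ?h2 i j y + \<phi> y * ?h3 k i j y
      + ?p2 k i y * ?h1 j y + ?p1 i y * ?h2 k j y + ?p2 k j y * ?h1 i y + ?p1 j y * ?h2 k i y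
      - kron i j * ((\<Sum>l\<in>UNIV. ?p2 l k y * ?h1 l y) + (\<Sum>l\<in>UNIV. ?p1 l y * ?h2 l k y)
        - lam / (\<phi> y)\<^sup>2 * ?p1 k y) = 0" if y: "y \<in> U" for k i j y
  proof -
    have "partial k (\<lambda>y. (n - 2) * (?p2 i j y - kron i j * s y) + \<phi> y * ?h2 i j y + ?p1 i y * ?h1 j y
      + ?p1 j y * ?h1 i y - kron i j * ((\<Sum>l\<in>UNIV. ?p1 l y * ?h1 l y) + lam / \<phi> y)) y
      = partial k (\<lambda>y. 0) y"
      by (rule partial_cong[OF open_U y E])
    then show ?thesis using D[OF y] Ds[OF y] nz[OF y]
      by (simp add: partial_sum partial_mult partial_add partial_diff partial_divide sum.distrib
          p2_sym[OF y, of k] h2_sym[OF y, of k] algebra_simps)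
  qed
  have V: "(\<Sum>i\<in>UNIV. (?p2 i j y - kron i j * s y) * ?h1 i y) = 0" if y: "y \<in> U" for j y
  proof (rule soliton_divergence[where ?p0.0 = "\<phi> y" and ?p1.0 = "\<lambda>i. ?p1 i y" and ?p2.0 = "\<lambda>i j. ?p2 i j y"
      and ?p3.0 = "\<lambda>k i j. ?p3 k i j y" and ?h1.0 = "\<lambda>i. ?h1 i y" and ?h2.0 = "\<lambda>i j. ?h2 i j y"
      and ?h3.0 = "\<lambda>k i j. ?h3 k i j y" and ?s1.0 = "\<lambda>k. partial k s y", OF n_def])
    show "n \<noteq> 2" using n by simp
    show "\<phi> y \<noteq> 0" using nz[OF y] .
    show "?p2 i j y = ?p2 j i y" "?h2 i j y = ?h2 j i y" "?p3 i i j y = ?p3 j i i y" "?h3 i i j y = ?h3 j i i y" for i j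
      using p2_sym[OF y] h2_sym[OF y] p3_sym[OF y] h3_sym[OF y] by metis+
    show "(\<Sum>i\<in>UNIV. (?p1 i y)\<^sup>2) = 2 * \<phi> y * s y"
      using nz[OF y] by (simp add: s_def power2_eq_square)
  qed (rule L[OF y] L1[OF y] S1[OF y] E[OF y] dE[OF y])+
  have dV: "(\<Sum>i\<in>UNIV. (?p2 i j y - kron i j * s y) * ?h2 k i y
      + (?p3 k i j y - kron i j * partial k s y) * ?h1 i y) = 0" if y: "y \<in> U" for j k y
  proof -
    have "partial k (\<lambda>y. \<Sum>i\<in>UNIV. (?p2 i j y - kron i j * s y) * ?h1 i y) y = partial k (\<lambda>y. 0) y"
      by (rule partial_cong[OF open_U y V])
    then show ?thesis using D[OF y] Ds[OF y] by (simp add: partial_sum partial_mult partial_diff)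
  qed
  have p2: "?p2 i j x = kron i j * s x" for i j
  proof (rule soliton_traceless_zero[where ?p0.0 = "\<phi> x" and ?p1.0 = "\<lambda>i. ?p1 i x" and ?p2.0 = "\<lambda>i j. ?p2 i j x"
      and ?p3.0 = "\<lambda>k i j. ?p3 k i j x" and ?h1.0 = "\<lambda>i. ?h1 i x" and ?h2.0 = "\<lambda>i j. ?h2 i j x"
      and ?s1.0 = "\<lambda>k. partial k s x", OF n_def n])
    show "\<phi> x \<noteq> 0" using nz[OF x] .
    show "?p2 i j x = ?p2 j i x" "?h2 i j x = ?h2 j i x" "?p3 i j i x = ?p3 j i i x" for i j
      using p2_sym[OF x] h2_sym[OF x] p3_sym[OF x] by metis+
  qed (rule L[OF x] L1[OF x] S1[OF x] E[OF x] V[OF x] dV[OF x])+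
  \<comment> \<open>Since \<open>s x / \<phi> x\<close> is \<open>dlog_sq x / 2\<close>, the Hessian
    terms of \<open>riemann_conformal\<close> cancel exactly against its \<open>dlog_sq\<close>
    term.\<close>
  then have b: "?p2 i j x / \<phi> x = kron i j * (dlog_sq x / 2)" for i j
    using nz[OF x] by (simp add: s_eq[OF x])
  show ?thesis
    unfolding riemann_conformal[OF x] b by (simp add: kron_commute algebra_simps)
qed

end

section \<open>Curvature under a change of coordinates\<close>

lemma matrix_add_rdistrib: "(B + C) ** A = B ** A + C ** (A :: real^'n^'m::finite)"
  by (simp add: vec_eq_iff matrix_matrix_mult_def sum.distrib distrib_right)

section \<open>Transformation law of the Christoffel symbols\<close>

definition christoffel1 ::
  "(real^'n::finite \<Rightarrow> real^'n^'n) \<Rightarrow> 'n \<Rightarrow> 'n \<Rightarrow> 'n \<Rightarrow> real^'n \<Rightarrow> real" where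
  "christoffel1 G l i j x = (partial i (\<lambda>y. G y $ j $ l) x + partial j (\<lambda>y. G y $ i $ l) x
        - partial l (\<lambda>y. G y $ i $ j) x) / 2"

lemma christoffel_christoffel1:
  "(\<chi> k. christoffel G k i j x) = matrix_inv (G x) *v (\<chi> l. christoffel1 G l i j x)"
  by (simp add: vec_eq_iff christoffel_def christoffel1_def matrix_vector_mult_def sum_divide_distrib)

text \<open>\<open>P i j l\<close> is the derivative of a pulled-back metric. It splits as
  \<open>Q i j l + Q i l j + T i j l\<close>, where \<open>Q\<close> pairs the second derivatives
  \<open>H\<close> of the map with its Jacobian and \<open>T\<close> is the pullback of
  \<open>dg\<close>. In the Christoffel combination the symmetry of \<open>H\<close> cancels all
  \<open>Q\<close> terms but twice \<open>Q i j l\<close>. Using symbols of the first kind keeps the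
  inverse metric out of this computation.\<close>

lemma christoffel1_pullback_algebra:
  fixes J :: "'n::finite \<Rightarrow> 'n \<Rightarrow> real" and g :: "'n \<Rightarrow> 'n \<Rightarrow> real"
    and H dg :: "'n \<Rightarrow> 'n \<Rightarrow> 'n \<Rightarrow> real"
  assumes H: "\<And>a i j. H a i j = H a j i" and g: "\<And>a b. g a b = g b a"
  defines "P \<equiv> \<lambda>i j l. (\<Sum>a\<in>UNIV. \<Sum>b\<in>UNIV. (H a i j * J b l + J a j * H b i l) * g a b
      + J a j * J b l * (\<Sum>c\<in>UNIV. J c i * dg c a b))"
  shows "(P i j l + P j i l - P l i j) / 2 = (\<Sum>a\<in>UNIV. J a l * ((\<Sum>b\<in>UNIV. g a b * H b i j)
      + (\<Sum>c\<in>UNIV. \<Sum>d\<in>UNIV. J c i * J d j * ((dg c d a + dg d c a - dg a c d) / 2))))"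
proof -
  define Q where "Q i j l = (\<Sum>a\<in>UNIV. \<Sum>b\<in>UNIV. H a i j * J b l * g a b)" for i j l
  define T where "T i j l = (\<Sum>c\<in>UNIV. \<Sum>d\<in>UNIV. \<Sum>e\<in>UNIV. J c i * J d j * J e l * dg c d e)" for i j l
  have Q_sym: "Q i j l = Q j i l" for i j l by (simp add: Q_def H[of _ i j])
  have "(\<Sum>a\<in>UNIV. \<Sum>b\<in>UNIV. J a j * H b i l * g a b) = Q i l j" for i j l
    unfolding Q_def by (subst sum.swap) (simp add: g[of _ a for a] mult_ac)
  moreover have "(\<Sum>a\<in>UNIV. \<Sum>b\<in>UNIV. J a j * J b l * (\<Sum>c\<in>UNIV. J c i * dg c a b)) = T i j l" for i j l
  proof -
    have "T i j l = (\<Sum>d\<in>UNIV. \<Sum>c\<in>UNIV. \<Sum>e\<in>UNIV. J c i * J d j * J e l * dg c d e)"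
      unfolding T_def by (rule sum.swap)
    also have "\<dots> = (\<Sum>d\<in>UNIV. \<Sum>e\<in>UNIV. \<Sum>c\<in>UNIV. J c i * J d j * J e l * dg c d e)"
      by (intro sum.cong refl sum.swap)
    finally show ?thesis by (simp add: sum_distrib_left mult_ac)
  qed
  ultimately have P: "P i j l = Q i j l + Q i l j + T i j l" for i j l
    unfolding P_def by (simp add: sum.distrib distrib_right) (simp add: Q_def)
  have 1: "(\<Sum>a\<in>UNIV. J a l * (\<Sum>b\<in>UNIV. g a b * H b i j)) = Q i j l"
    unfolding Q_def sum_distrib_left by (subst sum.swap) (simp add: g[of _ a for a] mult_ac)
  have 2: "(\<Sum>a\<in>UNIV. \<Sum>c\<in>UNIV. \<Sum>d\<in>UNIV. F c d a) = (\<Sum>c\<in>UNIV. \<Sum>d\<in>UNIV. \<Sum>a\<in>UNIV. F c d a)"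
    for F :: "'n \<Rightarrow> 'n \<Rightarrow> 'n \<Rightarrow> real"
    by (rule trans[OF sum.swap]) (intro sum.cong refl sum.swap)
  have T1: "(\<Sum>a\<in>UNIV. \<Sum>c\<in>UNIV. \<Sum>d\<in>UNIV. J a l * J c i * J d j * dg c d a) = T i j l"
    by (rule trans[OF 2]) (simp add: T_def mult_ac)
  have T2: "(\<Sum>a\<in>UNIV. \<Sum>c\<in>UNIV. \<Sum>d\<in>UNIV. J a l * J c i * J d j * dg d c a) = T j i l"
    by (rule trans[OF 2], rule trans[OF sum.swap]) (simp add: T_def mult_ac)
  have T3: "(\<Sum>a\<in>UNIV. \<Sum>c\<in>UNIV. \<Sum>d\<in>UNIV. J a l * J c i * J d j * dg a c d) = T l i j"
    unfolding T_def by (simp add: mult_ac)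
  have "(\<Sum>a\<in>UNIV. J a l * (\<Sum>c\<in>UNIV. \<Sum>d\<in>UNIV. J c i * J d j * ((dg c d a + dg d c a - dg a c d) / 2)))
    = (\<Sum>a\<in>UNIV. \<Sum>c\<in>UNIV. \<Sum>d\<in>UNIV. (J a l * J c i * J d j * dg c d a + J a l * J c i * J d j * dg d c a
      - J a l * J c i * J d j * dg a c d) / 2)"
    unfolding sum_distrib_left by (intro sum.cong refl) (simp add: algebra_simps)
  also have "\<dots> = (T i j l + T j i l - T l i j) / 2"
    by (simp add: sum.distrib sum_subtractf T1 T2 T3 flip: sum_divide_distrib)
  finally show ?thesis
    unfolding P using Q_sym[of i j l] Q_sym[of l i j] Q_sym[of l j i]
    by (simp add: distrib_left sum.distrib 1)
qed

text \<open>\<open>y\<close> stands for a transition map and \<open>z\<close> for its inverse.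
  Regularity is assumed for the target metric \<open>G'\<close> and its Christoffel symbols; that of
  \<open>G\<close> is derived from \<open>pullback\<close>.\<close>

locale coordinate_change =
  fixes W :: "(real^'n::finite) set" and y z :: "real^'n \<Rightarrow> real^'n" and G G' :: "real^'n \<Rightarrow> real^'n^'n"
  assumes open_W: "open W"
    and smooth_y: "smooth_map_on W y" and smooth_z: "smooth_map_on (y ` W) z"
    and inverse: "x \<in> W \<Longrightarrow> z (y x) = x"
    and pullback: "x \<in> W \<Longrightarrow> G x = transpose (jacobian y (at x)) ** G' (y x) ** jacobian y (at x)"
    and sym: "x \<in> W \<Longrightarrow> transpose (G' (y x)) = G' (y x)"
    and inv: "x \<in> W \<Longrightarrow> invertible (G' (y x))"
    and diff_G': "x \<in> W \<Longrightarrow> (\<lambda>u. G' u $ a $ b) differentiable (at (y x))"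
    and diff_\<Gamma>': "x \<in> W \<Longrightarrow> christoffel G' m a b differentiable (at (y x))"
begin

abbreviation J :: "'n \<Rightarrow> 'n \<Rightarrow> real^'n \<Rightarrow> real" where
  "J a i \<equiv> partial i (\<lambda>x. y x $ a)"

definition Jac :: "real^'n \<Rightarrow> real^'n^'n" where
  "Jac x = (\<chi> a i. J a i x)"

text \<open>The Jacobian of \<open>z\<close> at \<open>y x\<close>, used instead of
  \<open>matrix_inv (Jac x)\<close> because its entries are directly seen to be differentiable in
  \<open>x\<close>.\<close>

definition Jac_inv :: "real^'n \<Rightarrow> real^'n^'n" where
  "Jac_inv x = (\<chi> i a. partial a (\<lambda>u. z u $ i) (y x))"

lemma smooth_comp: "smooth_on W (\<lambda>x. y x $ a)"
  using smooth_y by (simp add: smooth_map_on_def)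

lemma differentiable_y: "x \<in> W \<Longrightarrow> y differentiable (at x)"
  unfolding differentiable_vec_iff using smooth_on_differentiable[OF smooth_comp] by blast

lemma differentiable_J: "x \<in> W \<Longrightarrow> J a i differentiable (at x)"
  by (rule smooth_on_differentiable[OF smooth_on_partial[OF smooth_comp]])

lemma partial_J_commute: "x \<in> W \<Longrightarrow> partial j (J a i) x = partial i (J a j) x"
  by (rule partial_commute[OF open_W smooth_comp])

lemma differentiable_compose:
  "x \<in> W \<Longrightarrow> f differentiable (at (y x)) \<Longrightarrow> (\<lambda>x. f (y x)) differentiable (at x)"
  using differentiable_chain_at[OF differentiable_y, of x f] by (simp add: o_def)

lemma jacobian_Jac:
  assumes x: "x \<in> W"
  shows "jacobian y (at x) = Jac x"
proof -
  obtain D where D: "(y has_derivative D) (at x)" using differentiable_y[OF x] by (auto simp: differentiable_def)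
  have "J a i x = D (axis i 1) $ a" for a i
    using bounded_linear.has_derivative[OF bounded_linear_vec_nth D] by (rule partial_eqI)
  then show ?thesis
    by (simp add: Jac_def jacobian_def matrix_def frechet_derivative_at[OF D, symmetric])
qed

lemma Jac_inv:
  assumes x: "x \<in> W"
  shows "Jac_inv x ** Jac x = mat 1" "Jac x ** Jac_inv x = mat 1"
proof -
  have "(\<Sum>a\<in>UNIV. J a i x * partial a (\<lambda>u. z u $ k) (y x)) = mat 1 $ k $ i" for k i
  proof -
    have "(\<lambda>u. z u $ k) differentiable (at (y x))"
      using smooth_z x by (intro smooth_on_differentiable) (auto simp: smooth_map_on_def)
    from partial_compose[OF this differentiable_y[OF x], of i, symmetric]
    have "(\<Sum>a\<in>UNIV. J a i x * partial a (\<lambda>u. z u $ k) (y x)) = partial i (\<lambda>x. z (y x) $ k) x" .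
    also have "\<dots> = partial i (\<lambda>x. x $ k) x"
      by (rule partial_cong[OF open_W x]) (simp add: inverse)
    also have "\<dots> = axis i 1 $ k"
      by (rule partial_eqI) (rule bounded_linear_imp_has_derivative, rule bounded_linear_vec_nth)
    finally show ?thesis by (simp add: mat_def axis_def)
  qed
  then show "Jac_inv x ** Jac x = mat 1"
    by (simp add: vec_eq_iff matrix_matrix_mult_def Jac_def Jac_inv_def mult.commute)
  then show "Jac x ** Jac_inv x = mat 1"
    by (simp add: matrix_left_right_inverse)
qed

lemma metric_comp:
  assumes x: "x \<in> W"
  shows "G x $ j $ l = (\<Sum>a\<in>UNIV. \<Sum>b\<in>UNIV. J a j x * J b l x * G' (y x) $ a $ b)"
proof -
  have "G x $ j $ l = (\<Sum>b\<in>UNIV. \<Sum>a\<in>UNIV. J a j x * G' (y x) $ a $ b * J b l x)"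
    by (simp add: pullback[OF x] jacobian_Jac[OF x] matrix_matrix_mult_def transpose_def Jac_def sum_distrib_right)
  also have "\<dots> = (\<Sum>a\<in>UNIV. \<Sum>b\<in>UNIV. J a j x * J b l x * G' (y x) $ a $ b)"
    by (subst sum.swap) (simp add: mult_ac)
  finally show ?thesis .
qed

lemma partial_metric:
  assumes x: "x \<in> W"
  shows "partial i (\<lambda>x. G x $ j $ l) x = (\<Sum>a\<in>UNIV. \<Sum>b\<in>UNIV.
     (partial i (J a j) x * J b l x + J a j x * partial i (J b l) x) * G' (y x) $ a $ b
     + J a j x * J b l x * (\<Sum>c\<in>UNIV. J c i x * partial c (\<lambda>u. G' u $ a $ b) (y x)))"
proof -
  have "partial i (\<lambda>x. G x $ j $ l) x
    = partial i (\<lambda>x. \<Sum>a\<in>UNIV. \<Sum>b\<in>UNIV. J a j x * J b l x * G' (y x) $ a $ b) x"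
    by (rule partial_cong[OF open_W x metric_comp])
  also have "\<dots> = (\<Sum>a\<in>UNIV. \<Sum>b\<in>UNIV. partial i (\<lambda>x. J a j x * J b l x * G' (y x) $ a $ b) x)"
    using differentiable_J[OF x] differentiable_compose[OF x diff_G'[OF x]]
    by (simp add: partial_sum)
  also have "\<dots> = (\<Sum>a\<in>UNIV. \<Sum>b\<in>UNIV.
     (partial i (J a j) x * J b l x + J a j x * partial i (J b l) x) * G' (y x) $ a $ b
     + J a j x * J b l x * (\<Sum>c\<in>UNIV. J c i x * partial c (\<lambda>u. G' u $ a $ b) (y x)))"
    using differentiable_J[OF x] differentiable_compose[OF x diff_G'[OF x]]
    by (intro sum.cong refl)
       (simp add: partial_mult partial_compose[OF diff_G'[OF x] differentiable_y[OF x]] add_ac)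
  finally show ?thesis .
qed

lemma christoffel1_pullback:
  assumes x: "x \<in> W"
  shows "christoffel1 G l i j x = (\<Sum>a\<in>UNIV. J a l x * ((\<Sum>b\<in>UNIV. G' (y x) $ a $ b * partial i (J b j) x)
    + (\<Sum>c\<in>UNIV. \<Sum>d\<in>UNIV. J c i x * J d j x * christoffel1 G' a c d (y x))))"
proof -
  have "G' (y x) $ a $ b = G' (y x) $ b $ a" for a b
    using sym[OF x] by (metis transpose_def vec_lambda_beta)
  from christoffel1_pullback_algebra[where H = "\<lambda>a i j. partial i (J a j) x" and g = "\<lambda>a b. G' (y x) $ a $ b",
    OF partial_J_commute[OF x] this]
  show ?thesis unfolding christoffel1_def partial_metric[OF x] by simp
qed

text \<open>The classical law, multiplied by the Jacobian so that its inverse does not appear. The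
  inverse of \<open>G x\<close> ends with the inverse transpose of \<open>Jac x\<close>, which
  cancels the transpose produced by \<open>christoffel1_pullback\<close>.\<close>

lemma christoffel_pullback:
  assumes x: "x \<in> W"
  shows "Jac x *v (\<chi> k. christoffel G k i j x)
    = (\<chi> m. partial i (J m j) x + (\<Sum>c\<in>UNIV. \<Sum>d\<in>UNIV. J c i x * J d j x * christoffel G' m c d (y x)))"
proof -
  let ?g = "G' (y x)" and ?v = "\<lambda>c d. (\<chi> a. christoffel1 G' a c d (y x))"
  have gi: "?g ** matrix_inv ?g = mat 1" "matrix_inv ?g ** ?g = mat 1"
    using inv[OF x] matrix_inv_eqI unfolding invertible_def by metis+
  have trJ: "transpose (Jac_inv x) ** transpose (Jac x) = mat 1"
    "transpose (Jac x) ** transpose (Jac_inv x) = mat 1"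
    using Jac_inv[OF x] by (simp_all flip: matrix_transpose_mul)
  have Ginv: "matrix_inv (G x) = Jac_inv x ** matrix_inv ?g ** transpose (Jac_inv x)"
  proof (rule matrix_inv_eqI)
    show "G x ** (Jac_inv x ** matrix_inv ?g ** transpose (Jac_inv x)) = mat 1"
      unfolding pullback[OF x] jacobian_Jac[OF x]
      by (metis Jac_inv(2)[OF x] gi(1) matrix_mul_assoc matrix_mul_rid trJ(2))
    show "Jac_inv x ** matrix_inv ?g ** transpose (Jac_inv x) ** G x = mat 1"
      unfolding pullback[OF x] jacobian_Jac[OF x]
      by (metis Jac_inv(1)[OF x] gi(2) matrix_mul_assoc matrix_mul_rid trJ(1))
  qed
  \<comment> \<open>Chosen so that the first-kind symbols of \<open>G\<close> are
    \<open>transpose (Jac x) *v w\<close>; applying \<open>matrix_inv ?g\<close> to \<open>w\<close>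
    raises the index and gives the right-hand side.\<close>
  define w where "w = ?g *v (\<chi> b. partial i (J b j) x)
    + (\<Sum>c\<in>UNIV. \<Sum>d\<in>UNIV. (J c i x * J d j x) *\<^sub>R ?v c d)"
  have "(\<chi> l. christoffel1 G l i j x) = transpose (Jac x) *v w"
    by (simp add: vec_eq_iff christoffel1_pullback[OF x] w_def matrix_vector_mult_def transpose_def Jac_def)
  then have "Jac x *v (\<chi> k. christoffel G k i j x)
    = (Jac x ** Jac_inv x) *v (matrix_inv ?g *v ((transpose (Jac_inv x) ** transpose (Jac x)) *v w))"
    unfolding christoffel_christoffel1 Ginv by (simp only: matrix_vector_mul_assoc matrix_mul_assoc)
  also have "\<dots> = matrix_inv ?g *v w"
    by (simp add: Jac_inv[OF x] trJ)
  also have "\<dots> = (\<chi> b. partial i (J b j) x)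
    + (\<Sum>c\<in>UNIV. \<Sum>d\<in>UNIV. (J c i x * J d j x) *\<^sub>R (matrix_inv ?g *v ?v c d))"
    unfolding w_def
    by (simp add: matrix_vector_right_distrib matrix_vector_mul_assoc gi
        linear_sum[OF matrix_vector_mul_linear] matrix_vector_mult_scaleR)
  finally show ?thesis
    unfolding christoffel_christoffel1[symmetric] by (simp add: vec_eq_iff)
qed

section \<open>Connection matrices and the pullback of curvature\<close>

definition conn :: "'n \<Rightarrow> real^'n \<Rightarrow> real^'n^'n" where
  "conn i x = (\<chi> k j. christoffel G k i j x)"

text \<open>Only the direction index is pulled back; \<open>m\<close> and \<open>b\<close> still
  refer to the target frame. These are the matrices of the connection of \<open>G'\<close> on the
  bundle pulled back along \<open>y\<close>.\<close>

definition pulled_conn :: "'n \<Rightarrow> real^'n \<Rightarrow> real^'n^'n" where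
  "pulled_conn i x = (\<chi> m b. \<Sum>a\<in>UNIV. J a i x * christoffel G' m a b (y x))"

text \<open>\<open>christoffel_pullback\<close> read as a gauge transformation, with
  \<open>Jac\<close> as the change of frame between the two connections.\<close>

lemma conn_eq:
  assumes x: "x \<in> W"
  shows "Jac x ** conn i x = (\<chi> m k. partial i (J m k) x) + pulled_conn i x ** Jac x"
proof -
  have "(Jac x ** conn i x) $ m $ k = partial i (J m k) x + (pulled_conn i x ** Jac x) $ m $ k" for m k
  proof -
    have "(Jac x ** conn i x) $ m $ k = (Jac x *v (\<chi> l. christoffel G l i k x)) $ m"
      by (simp add: matrix_matrix_mult_def matrix_vector_mult_def conn_def)
    also have "\<dots> = partial i (J m k) x + (\<Sum>c\<in>UNIV. \<Sum>d\<in>UNIV. J c i x * J d k x * christoffel G' m c d (y x))"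
      by (simp add: christoffel_pullback[OF x])
    also have "(\<Sum>c\<in>UNIV. \<Sum>d\<in>UNIV. J c i x * J d k x * christoffel G' m c d (y x))
      = (pulled_conn i x ** Jac x) $ m $ k"
      by (subst sum.swap) (simp add: matrix_matrix_mult_def pulled_conn_def Jac_def sum_distrib_left sum_distrib_right mult_ac)
    finally show ?thesis .
  qed
  then show ?thesis by (simp add: vec_eq_iff)
qed

lemma differentiable_pulled_conn:
  assumes x: "x \<in> W"
  shows "(\<lambda>x. pulled_conn i x $ m $ b) differentiable (at x)"
  unfolding pulled_conn_def using differentiable_J[OF x] differentiable_compose[OF x diff_\<Gamma>'[OF x]]
  by simp

text \<open>Solving \<open>conn_eq\<close> for \<open>conn\<close> expresses the symbols of
  \<open>G\<close> by sums and products of differentiable functions; \<open>matrix_inv (G x)\<close>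
  never has to be differentiated.\<close>

lemma differentiable_conn:
  assumes x: "x \<in> W"
  shows "christoffel G k i j differentiable (at x)"
proof -
  have eq: "christoffel G k i j u = (\<Sum>m\<in>UNIV. Jac_inv u $ k $ m *
      (partial i (J m j) u + (\<Sum>b\<in>UNIV. pulled_conn i u $ m $ b * J b j u)))" if u: "u \<in> W" for u
  proof -
    have "conn i u = Jac_inv u ** (Jac u ** conn i u)"
      by (simp add: matrix_mul_assoc Jac_inv[OF u])
    then have "conn i u $ k $ j = (Jac_inv u ** (Jac u ** conn i u)) $ k $ j" by simp
    then show ?thesis
      unfolding conn_eq[OF u] by (simp add: conn_def matrix_matrix_mult_def Jac_def)
  qed
  have z: "partial m (\<lambda>u. z u $ k) differentiable (at (y x))" for m
    using smooth_z x
    by (intro smooth_on_differentiable[OF smooth_on_partial]) (auto simp: smooth_map_on_def)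
  have "(\<lambda>u. Jac_inv u $ k $ m) differentiable (at x)" for m
    using differentiable_compose[OF x z] by (simp add: Jac_inv_def)
  moreover have "partial i (J m j) differentiable (at x)" for m
    by (rule smooth_on_differentiable[OF smooth_on_partial[OF smooth_on_partial[OF smooth_comp]] x])
  ultimately have "(\<lambda>u. \<Sum>m\<in>UNIV. Jac_inv u $ k $ m *
      (partial i (J m j) u + (\<Sum>b\<in>UNIV. pulled_conn i u $ m $ b * J b j u))) differentiable (at x)"
    using differentiable_pulled_conn[OF x] differentiable_J[OF x] by simp
  then obtain D where "((\<lambda>u. \<Sum>m\<in>UNIV. Jac_inv u $ k $ m *
      (partial i (J m j) u + (\<Sum>b\<in>UNIV. pulled_conn i u $ m $ b * J b j u))) has_derivative D) (at x)"
    by (auto simp: differentiable_def)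
  then have "(christoffel G k i j has_derivative D) (at x)"
    by (rule has_derivative_transform_within_open[OF _ open_W x]) (simp add: eq)
  then show ?thesis by (auto simp: differentiable_def)
qed

definition dconn :: "'n \<Rightarrow> 'n \<Rightarrow> real^'n \<Rightarrow> real^'n^'n" where
  "dconn i j x = (\<chi> l k. partial i (christoffel G l j k) x)"

definition dpulled_conn :: "'n \<Rightarrow> 'n \<Rightarrow> real^'n \<Rightarrow> real^'n^'n" where
  "dpulled_conn i j x = (\<chi> m b. partial i (\<lambda>x. pulled_conn j x $ m $ b) x)"

lemma conn_eq_derivative:
  assumes x: "x \<in> W"
  shows "(\<chi> m k. partial i (J m k) x) ** conn j x + Jac x ** dconn i j x
    = (\<chi> m k. partial i (partial j (J m k)) x) + dpulled_conn i j x ** Jac x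
      + pulled_conn j x ** (\<chi> m k. partial i (J m k) x)"
proof -
  have "(\<Sum>l\<in>UNIV. partial i (J m l) x * christoffel G l j k x)
      + (\<Sum>l\<in>UNIV. J m l x * partial i (christoffel G l j k) x)
    = partial i (partial j (J m k)) x + (\<Sum>b\<in>UNIV. partial i (\<lambda>x. pulled_conn j x $ m $ b) x * J b k x)
      + (\<Sum>b\<in>UNIV. pulled_conn j x $ m $ b * partial i (J b k) x)" for m k
  proof -
    have "(\<Sum>l\<in>UNIV. J m l u * christoffel G l j k u)
      = partial j (J m k) u + (\<Sum>b\<in>UNIV. pulled_conn j u $ m $ b * J b k u)" if "u \<in> W" for u
      using arg_cong[OF conn_eq[OF that, of j], of "\<lambda>M. M $ m $ k"]
      by (simp add: matrix_matrix_mult_def Jac_def conn_def)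
    then have "partial i (\<lambda>u. \<Sum>l\<in>UNIV. J m l u * christoffel G l j k u) x
      = partial i (\<lambda>u. partial j (J m k) u + (\<Sum>b\<in>UNIV. pulled_conn j u $ m $ b * J b k u)) x"
      by (rule partial_cong[OF open_W x])
    moreover have "partial j (J m k) differentiable (at x)"
      by (rule smooth_on_differentiable[OF smooth_on_partial[OF smooth_on_partial[OF smooth_comp]] x])
    ultimately show ?thesis
      using differentiable_pulled_conn[OF x] differentiable_J[OF x] differentiable_conn[OF x]
      by (simp add: partial_sum partial_mult partial_add sum.distrib add_ac)
  qed
  then show ?thesis
    by (simp add: vec_eq_iff matrix_matrix_mult_def Jac_def conn_def dconn_def dpulled_conn_def)
qed

lemma riemann_matrix:
  "riemann G l k i j x = (dconn i j x + conn i x ** conn j x) $ l $ k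
    - (dconn j i x + conn j x ** conn i x) $ l $ k"
  by (simp add: riemann_def dconn_def conn_def matrix_matrix_mult_def sum_subtractf)

text \<open>The terms containing second derivatives of \<open>y\<close> are symmetric in
  \<open>i\<close> and \<open>j\<close> and drop out of the difference. What remains is the
  curvature of \<open>G'\<close> with its two direction indices contracted with the
  Jacobian.\<close>

lemma pulled_curvature:
  assumes x: "x \<in> W"
  shows "(dpulled_conn i j x + pulled_conn i x ** pulled_conn j x) $ m $ b
    - (dpulled_conn j i x + pulled_conn j x ** pulled_conn i x) $ m $ b
    = (\<Sum>c\<in>UNIV. \<Sum>a\<in>UNIV. J c i x * J a j x * riemann G' m b c a (y x))"
proof -
  define C where "C = (\<lambda>m a b. christoffel G' m a b (y x))"
  define dC where "dC = (\<lambda>c m a b. partial c (christoffel G' m a b) (y x))"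
  have d: "dpulled_conn i j x $ m $ b = (\<Sum>a\<in>UNIV. partial i (J a j) x * C m a b)
    + (\<Sum>c\<in>UNIV. \<Sum>a\<in>UNIV. J c i x * J a j x * dC c m a b)" for i j
  proof -
    have "dpulled_conn i j x $ m $ b = (\<Sum>a\<in>UNIV. partial i (J a j) x * C m a b
      + J a j x * (\<Sum>c\<in>UNIV. J c i x * dC c m a b))"
      unfolding dpulled_conn_def pulled_conn_def C_def dC_def
      using differentiable_J[OF x] differentiable_compose[OF x diff_\<Gamma>'[OF x]]
      by (simp add: partial_sum partial_mult partial_compose[OF diff_\<Gamma>'[OF x] differentiable_y[OF x]] add_ac)
    also have "\<dots> = (\<Sum>a\<in>UNIV. partial i (J a j) x * C m a b)
      + (\<Sum>a\<in>UNIV. \<Sum>c\<in>UNIV. J c i x * J a j x * dC c m a b)"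
      by (simp add: sum.distrib sum_distrib_left mult_ac)
    also have "(\<Sum>a\<in>UNIV. \<Sum>c\<in>UNIV. J c i x * J a j x * dC c m a b)
      = (\<Sum>c\<in>UNIV. \<Sum>a\<in>UNIV. J c i x * J a j x * dC c m a b)"
      by (rule sum.swap)
    finally show ?thesis .
  qed
  have p: "(pulled_conn i x ** pulled_conn j x) $ m $ b
    = (\<Sum>c\<in>UNIV. \<Sum>a\<in>UNIV. J c i x * J a j x * (\<Sum>e\<in>UNIV. C m c e * C e a b))" for i j
  proof -
    have "(pulled_conn i x ** pulled_conn j x) $ m $ b
      = (\<Sum>e\<in>UNIV. \<Sum>c\<in>UNIV. \<Sum>a\<in>UNIV. J c i x * J a j x * (C m c e * C e a b))"
      by (simp add: matrix_matrix_mult_def pulled_conn_def C_def sum_product mult_ac)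
    also have "\<dots> = (\<Sum>c\<in>UNIV. \<Sum>e\<in>UNIV. \<Sum>a\<in>UNIV. J c i x * J a j x * (C m c e * C e a b))"
      by (rule sum.swap)
    also have "\<dots> = (\<Sum>c\<in>UNIV. \<Sum>a\<in>UNIV. \<Sum>e\<in>UNIV. J c i x * J a j x * (C m c e * C e a b))"
      by (intro sum.cong refl sum.swap)
    finally show ?thesis by (simp add: sum_distrib_left)
  qed
  have "riemann G' m b c a (y x) = dC c m a b + (\<Sum>e\<in>UNIV. C m c e * C e a b)
      - (dC a m c b + (\<Sum>e\<in>UNIV. C m a e * C e c b))" for c a
    by (simp add: riemann_def C_def dC_def sum_subtractf)
  then have "(\<Sum>c\<in>UNIV. \<Sum>a\<in>UNIV. J c i x * J a j x * riemann G' m b c a (y x))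
    = (\<Sum>c\<in>UNIV. \<Sum>a\<in>UNIV. J c i x * J a j x * dC c m a b)
    + (\<Sum>c\<in>UNIV. \<Sum>a\<in>UNIV. J c i x * J a j x * (\<Sum>e\<in>UNIV. C m c e * C e a b))
    - (\<Sum>c\<in>UNIV. \<Sum>a\<in>UNIV. J c i x * J a j x * (dC a m c b + (\<Sum>e\<in>UNIV. C m a e * C e c b)))"
    by (simp add: right_diff_distrib distrib_left sum.distrib sum_subtractf)
  \<comment> \<open>Exchanging the order of summation brings the subtracted half into the form of
    \<open>d\<close> and \<open>p\<close> with \<open>i\<close> and \<open>j\<close>
    interchanged.\<close>
  also have "(\<Sum>c\<in>UNIV. \<Sum>a\<in>UNIV. J c i x * J a j x * (dC a m c b + (\<Sum>e\<in>UNIV. C m a e * C e c b)))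
    = (\<Sum>a\<in>UNIV. \<Sum>c\<in>UNIV. J a j x * J c i x * dC a m c b)
    + (\<Sum>a\<in>UNIV. \<Sum>c\<in>UNIV. J a j x * J c i x * (\<Sum>e\<in>UNIV. C m a e * C e c b))"
    by (subst sum.swap) (simp add: distrib_left sum.distrib mult_ac)
  finally show ?thesis
    by (simp add: d p partial_J_commute[OF x, of i j])
qed

text \<open>Write \<open>\<Gamma>\<^sub>i\<close> for \<^term>\<open>conn i\<close> and \<open>\<Omega>\<^sub>i\<close> for \<^term>\<open>pulled_conn i\<close>. Combining \<open>J \<Gamma>\<^sub>j = \<partial>\<^sub>j J + \<Omega>\<^sub>j J\<close>
  with its derivative in direction \<open>i\<close> shows that
  \<open>J (\<partial>\<^sub>i \<Gamma>\<^sub>j + \<Gamma>\<^sub>i \<Gamma>\<^sub>j) - (\<partial>\<^sub>i \<Omega>\<^sub>j + \<Omega>\<^sub>i \<Omega>\<^sub>j) J\<close> is symmetric in \<open>i\<close> and \<open>j\<close>.\<close>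

lemma curvature_pullback:
  assumes x: "x \<in> W" and flat: "\<And>m b c a. riemann G' m b c a (y x) = 0"
  shows "riemann G l k i j x = 0"
proof -
  let ?dJ = "\<lambda>i. \<chi> m k. partial i (J m k) x" and ?ddJ = "\<lambda>i j. \<chi> m k. partial i (partial j (J m k)) x"
  let ?\<Gamma> = "\<lambda>i. conn i x" and ?\<Omega> = "\<lambda>i. pulled_conn i x" and ?J = "Jac x"
  have "?J ** (dconn i j x + ?\<Gamma> i ** ?\<Gamma> j) = ?ddJ i j + (dpulled_conn i j x + ?\<Omega> i ** ?\<Omega> j) ** ?J
    + (?\<Omega> i ** ?dJ j + ?\<Omega> j ** ?dJ i)" for i j
  proof -
    have "?J ** (dconn i j x + ?\<Gamma> i ** ?\<Gamma> j) = ?J ** dconn i j x + (?J ** ?\<Gamma> i) ** ?\<Gamma> j"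
      by (simp add: matrix_add_ldistrib matrix_mul_assoc)
    also have "\<dots> = (?dJ i ** ?\<Gamma> j + ?J ** dconn i j x) + ?\<Omega> i ** (?J ** ?\<Gamma> j)"
      unfolding conn_eq[OF x, of i] by (simp add: matrix_add_rdistrib matrix_mul_assoc add_ac)
    also have "\<dots> = ?ddJ i j + dpulled_conn i j x ** ?J + ?\<Omega> j ** ?dJ i + ?\<Omega> i ** (?dJ j + ?\<Omega> j ** ?J)"
      unfolding conn_eq[OF x, of j] conn_eq_derivative[OF x] ..
    finally show ?thesis
      by (simp add: matrix_add_rdistrib matrix_add_ldistrib matrix_mul_assoc add_ac)
  qed
  moreover have "?ddJ i j = ?ddJ j i"
    by (simp add: vec_eq_iff partial_commute[OF open_W smooth_on_partial[OF smooth_comp] x, of i j])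
  moreover have "dpulled_conn i j x + ?\<Omega> i ** ?\<Omega> j = dpulled_conn j i x + ?\<Omega> j ** ?\<Omega> i"
    using pulled_curvature[OF x] flat by (simp add: vec_eq_iff)
  ultimately have "?J ** (dconn i j x + ?\<Gamma> i ** ?\<Gamma> j) = ?J ** (dconn j i x + ?\<Gamma> j ** ?\<Gamma> i)"
    by (simp add: add_ac)
  then have "Jac_inv x ** (?J ** (dconn i j x + ?\<Gamma> i ** ?\<Gamma> j)) = Jac_inv x ** (?J ** (dconn j i x + ?\<Gamma> j ** ?\<Gamma> i))"
    by simp
  then have "dconn i j x + ?\<Gamma> i ** ?\<Gamma> j = dconn j i x + ?\<Gamma> j ** ?\<Gamma> i"
    by (simp add: matrix_mul_assoc Jac_inv[OF x])
  then show ?thesis by (simp add: riemann_matrix)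
qed

end

section \<open>Charts\<close>

lemma smooth_on_const: "smooth_on S (\<lambda>x. c)"
proof -
  have "Ck_on k S (\<lambda>x. c)" for k
  proof (induction k arbitrary: c)
    case (Suc k)
    have "partial i (\<lambda>x. c) = (\<lambda>x. 0)" for i :: 'a
      by (rule ext) (rule partial_const)
    then show ?case using Suc by simp
  qed simp
  then show ?thesis by (simp add: smooth_on_def)
qed

text \<open>For the zero potential each term of the soliton equation vanishes separately. The zero
  potential may differ from the given one: on flat space a Gaussian soliton has \<open>lam\<close>
  different from 0.\<close>

lemma flat_imp_steady:
  assumes "flat A g"
  shows "steady_gradient_rho_Einstein_soliton \<rho> A g"
proof -
  have ric: "ricci (g c) i j x = 0" if "c \<in> A" "x \<in> chart_image c" for c x i j
    using assms that by (simp add: flat_def ricci_def)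
  have zero: "(\<lambda>_. 0) \<circ> u = (\<lambda>_. 0)" for u :: "real^'b \<Rightarrow> 'a" by (simp add: o_def)
  have "partial j (\<lambda>_. 0 :: real) = (\<lambda>_. 0)" for j :: 'b
    by (rule ext) (rule partial_const)
  then have "soliton_equation \<rho> 0 A g (\<lambda>_. 0)"
    by (simp add: soliton_equation_def ric scalar_curvature_def hessian_def zero)
  moreover have "smooth_function A (\<lambda>_. 0)"
    by (simp add: smooth_function_def zero smooth_on_const)
  ultimately show ?thesis unfolding steady_gradient_rho_Einstein_soliton_def by blast
qed

lemma chart_inv_left:
  assumes "is_chart X c" "p \<in> fst c"
  shows "chart_inv c (snd c p) = p"
proof -
  have "topspace (subtopology X (fst c)) = fst c"
    using assms(1) openin_subset by (auto simp: is_chart_def)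
  then have "inj_on (snd c) (fst c)"
    using assms(1) by (metis homeomorphic_imp_injective_map is_chart_def)
  then show ?thesis using assms(2) by (simp add: chart_inv_def inv_into_f_f)
qed

lemma open_overlap_image:
  assumes "is_chart X c" "is_chart X d"
  shows "open (overlap_image c d)"
proof -
  have "openin (subtopology X (fst c)) (fst c \<inter> fst d)"
    using assms by (auto simp: is_chart_def openin_subtopology_Int2)
  moreover have "open_map (subtopology X (fst c)) (top_of_set (chart_image c)) (snd c)"
    using assms(1) by (simp add: is_chart_def homeomorphic_imp_open_map)
  ultimately have "openin (top_of_set (chart_image c)) (overlap_image c d)"
    by (simp add: open_map_def overlap_image_def)
  then show ?thesis using assms(1) by (auto simp: is_chart_def intro: openin_open_trans)
qed

lemma transition_image:
  assumes "is_chart X c"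
  shows "transition c d ` overlap_image c d = overlap_image d c"
  using chart_inv_left[OF assms] by (force simp: transition_def overlap_image_def)

lemma transition_inverse:
  assumes "is_chart X c" "is_chart X d" "x \<in> overlap_image c d"
  shows "transition d c (transition c d x) = x"
  using assms(3) chart_inv_left[OF assms(1)] chart_inv_left[OF assms(2)]
  by (auto simp: transition_def overlap_image_def)

theorem corollary1p9:
  fixes \<rho> :: real
    and X :: "'a topology"
    and A :: "('a, 'n::finite) chart set"
    and g :: "('a, 'n) metric"
  assumes "\<rho> \<noteq> 0"
    and "CARD('n) \<ge> 3"
    and "riemannian_manifold X A g"
    and "gradient_rho_Einstein_soliton \<rho> A g"
    and "locally_conformally_flat X A g"
    and "rotationally_symmetric X A g"
    and "zero_scalar_curvature A g"
  shows "steady_gradient_rho_Einstein_soliton \<rho> A g \<and> flat A g"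
proof -
  have manifold: "smooth_manifold X A" and riem: "riemannian_metric A g"
    using assms(3) by (auto simp: riemannian_manifold_def)
  have chart: "is_chart X c" if "c \<in> A" for c
    using manifold that by (simp add: smooth_manifold_def)
  obtain h lam where h: "smooth_function A h" "soliton_equation \<rho> lam A g h"
    using assms(4) by (auto simp: gradient_rho_Einstein_soliton_def)
  have "riemann (g c) l k i j x = 0" if c: "c \<in> A" and x: "x \<in> chart_image c" for c x l k i j
  proof -
    \<comment> \<open>\<open>c\<close> is an arbitrary chart of the atlas; a chart \<open>d\<close>
      with conformal coordinates is chosen around the point with coordinates
      \<open>x\<close>.\<close>
    obtain p where p: "p \<in> fst c" "x = snd c p" using x by (auto simp: chart_image_def)
    have "p \<in> topspace X" using p(1) chart[OF c] openin_subset by (fastforce simp: is_chart_def)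
    then obtain d \<phi> where d: "d \<in> A" "p \<in> fst d" and \<phi>: "smooth_on (chart_image d) \<phi>"
      "\<And>u. u \<in> chart_image d \<Longrightarrow> \<phi> u > 0 \<and> g d u = (1 / (\<phi> u)\<^sup>2) *\<^sub>R mat 1"
      using assms(5) by (auto simp: locally_conformally_flat_def)
    interpret conf: conformal_metric "chart_image d" \<phi> "g d"
      by unfold_locales (use \<phi> chart[OF d(1)] in \<open>auto simp: is_chart_def\<close>)
    have flat_d: "riemann (g d) l k i j u = 0" if u: "u \<in> chart_image d" for l k i j u
    proof (rule conf.scalar_flat_soliton[OF assms(2) _ _ _ u])
      show "smooth_on (chart_image d) (h \<circ> chart_inv d)"
        using h(1) d(1) by (simp add: smooth_function_def)
      show scal: "scalar_curvature (g d) u = 0" if "u \<in> chart_image d" for u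
        using assms(7) d(1) that by (simp add: zero_scalar_curvature_def)
      \<comment> \<open>Vanishing scalar curvature removes the term with \<rho>.\<close>
      show "ricci (g d) i j u + hessian (g d) (h \<circ> chart_inv d) i j u = lam * g d u $ i $ j"
        if "u \<in> chart_image d" for u i j
        using h(2) d(1) that scal[OF that] by (simp add: soliton_equation_def)
    qed
    have xW: "x \<in> overlap_image c d" using p d(2) by (auto simp: overlap_image_def)
    have image: "transition c d u \<in> chart_image d" if "u \<in> overlap_image c d" for u
      using that transition_image[OF chart[OF c], of d]
      by (force simp: overlap_image_def chart_image_def)
    have compat: "compatible c d" using manifold c d(1) by (simp add: smooth_manifold_def)
    \<comment> \<open>The conformal chart \<open>d\<close> is taken as the target, so that the
      explicit formula for its Christoffel symbols supplies their differentiability and its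
      vanishing curvature is pulled back to \<open>c\<close>.\<close>
    interpret change: coordinate_change "overlap_image c d" "transition c d" "transition d c" "g c" "g d"
    proof
      fix u m a b assume u: "u \<in> overlap_image c d"
      show "g c u = transpose (jacobian (transition c d) (at u)) ** g d (transition c d u)
          ** jacobian (transition c d) (at u)"
        using riem c d(1) u by (simp add: riemannian_metric_def Let_def)
      show "transpose (g d (transition c d u)) = g d (transition c d u)"
        using riem d(1) image[OF u] by (simp add: riemannian_metric_def)
      show "(\<lambda>v. g d v $ a $ b) differentiable (at (transition c d u))"
        using riem d(1) image[OF u] smooth_on_differentiable by (fastforce simp: riemannian_metric_def)
    qed (use compat transition_inverse[OF chart[OF c] chart[OF d(1)]] open_overlap_image[OF chart[OF c] chart[OF d(1)]]
        transition_image[OF chart[OF c]] conf.invertible_metric conf.differentiable_christoffel image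
        in \<open>auto simp: compatible_def\<close>)
    show ?thesis by (rule change.curvature_pullback[OF xW flat_d[OF image[OF xW]]])
  qed
  then have "flat A g" by (simp add: flat_def)
  then show ?thesis using flat_imp_steady by blast
qed

end
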